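(* Let $P,Q$ be probability distributions on finite sets and $s_2\in\mathbb R$. When the first-order rate pair $(s_1,t_1)$ is semi-admissible but not admissible, the function $$F_{P,Q,s_1,s_2}(t_2)=\sqrt{\Phi\left(\sqrt{\frac{H(Q)}{V(Q)s_1}}\,\big(s_2-H(Q)t_2\big)\right)}$$ is continuous and strictly monotonically decreasing on $F_{P,Q,s_1,s_2}^{-1}((0,1))$, and satisfies $$F_{P,Q,s_1,s_2}(t_2)=F^{\mathcal D}_{P,Q,s_1,s_2}(t_2)=F^{\mathcal M}_{P,Q,s_1,s_2}(t_2)\quad\text{for arbitrary }t_2\in\mathbb R.$$
   Context: All logarithms are to base $2$. $\Phi$ is the standard normal cumulative distribution function. $\mathcal P(\mathcal X)$ is the set of probability distributions on a finite set $\mathcal X$; $P^n$ is the $n$-fold i.i.d. product of $P$. $H(Q)=-\sum_x Q(x)\log Q(x)$ and $V(Q)=\sum_x Q(x)(-\log Q(x)-H(Q))^2$. For a map $f:\mathcal X\to\mathcal Y$, $W_f(P)(y)=\sum_{x\in f^{-1}(y)}P(x)$. The fidelity is $F(Q,Q')=\sum_y\sqrt{Q(y)}\sqrt{Q'(y)}$. $P^{\downarrow}_i$ is the $i$-th largest value of $P$ (and $0$ beyond the size of the set). $P\prec Q$ means $\sum_{i=1}^l P^{\downarrow}_i\le\sum_{i=1}^l Q^{\downarrow}_i$ for all $l$ (the underlying finite sets may differ). A storage of $N$ bits is $\{0,1\}^N$. Non-integer storage sizes and non-integer exponents (numbers of copies) are understood up to rounding: for real $N\ge 0$, $\{0,1\}^N$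 is read as a set of $\lfloor 2^N\rfloor$ elements, and $Q^t$ as $Q^{\lfloor t\rfloor}$. For $P\in\mathcal P(\mathcal X)$, $Q\in\mathcal P(\mathcal Y)$, $$F^{\mathcal D}(P\to Q|N)=\sup_{f:\mathcal X\to\{0,1\}^N,\ f':\{0,1\}^N\to\mathcal Y}F(W_{f'}\circ W_f(P),Q),$$ $$F^{\mathcal M}(P\to Q|N)=\sup\{F(P'',Q)\mid P''\in\mathcal P(\mathcal Y),\ \exists P'\in\mathcal P(\{0,1\}^N):\ P\prec P'\prec P''\}.$$ First-order rate pairs: for $\nu\in(0,1)$, a pair $(s_1,t_1)$ with $s_1,t_1>0$ is achievable if $\liminf_{n\to\infty}F^i(P^n\to Q^{t_1n}|s_1n)\ge\nu$; the set of achievable pairs is the same for $i=\mathcal D$ and $i=\mathcal M$ and for all $\nu\in(0,1)$, namely $\{(s_1,t_1)\mid 0<s_1,\ 0<t_1\le\min\{H(P),s_1\}/H(Q)\}$. A pair $(s_1,t_1)$ dominates $(s_1',t_1')$ if $s_1\le s_1'$ and $t_1\ge t_1'$, and simulates it if $s_1'/s_1=t_1'/t_1\le1$. An achievable pair is semi-admissible if no other achievable pair dominates it, and admissible if no other achievable pair dominates or simulates it. Thus $(s_1,t_1)$ is semi-admissible iff $0<s_1\le H(P)$ and $t_1=s_1/H(Q)$, and the unique admissible pair is $(H(P),H(P)/H(Q))$; so semi-admissible but not admissible means $0<s_1<H(P)$ and $t_1=s_1/H(Q)$. For $i\in\{\mathcal D,\mathcal M\}$, $$F^i_{P,Q,s_1,s_2}(t_2)=\liminf_{n\to\infty}F^i\Big(P^n\to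 Q^{\frac{s_1}{H(Q)}n+t_2\sqrt n}\,\Big|\,s_1n+s_2\sqrt n\Big).$$ *)

theory Defs
  imports "HOL-Probability.Probability"
begin

definition shannon_entropy :: "'a::finite pmf \<Rightarrow> real" where
  "shannon_entropy Q = - (\<Sum>x\<in>UNIV. pmf Q x * log 2 (pmf Q x))"

definition varentropy :: "'a::finite pmf \<Rightarrow> real" where
  "varentropy Q = (\<Sum>x\<in>UNIV. pmf Q x * (- log 2 (pmf Q x) - shannon_entropy Q)\<^sup>2)"

definition Phi :: "real \<Rightarrow> real" where
  "Phi x = cdf std_normal_distribution x"

text \<open>
  Product alphabets and storages vary in size with the number of copies, so the general notions
  below carry an explicit finite carrier set. The distributions on a carrier \<open>X\<close> are the pmfs
  whose support lies in \<open>X\<close>.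
\<close>

definition distributions_on :: "'a set \<Rightarrow> 'a pmf set" where
  "distributions_on X = {P. set_pmf P \<subseteq> X}"

definition fidelity :: "'a set \<Rightarrow> 'a pmf \<Rightarrow> 'a pmf \<Rightarrow> real" where
  "fidelity Y Q Q' = (\<Sum>y\<in>Y. sqrt (pmf Q y) * sqrt (pmf Q' y))"

text \<open>Indices start at 0: \<open>decreasing_value X P i\<close> is the \<open>(i + 1)\<close>-th largest value of \<open>P\<close>.\<close>

definition decreasing_value :: "'a set \<Rightarrow> 'a pmf \<Rightarrow> nat \<Rightarrow> real" where
  "decreasing_value X P i =
     (let vs = rev (sorted_list_of_multiset (image_mset (pmf P) (mset_set X)))
      in if i < length vs then vs ! i else 0)"

definition majorized :: "'a set \<Rightarrow> 'a pmf \<Rightarrow> 'b set \<Rightarrow> 'b pmf \<Rightarrow> bool" where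
  "majorized X P Y Q \<longleftrightarrow>
     (\<forall>l. (\<Sum>i<l. decreasing_value X P i) \<le> (\<Sum>i<l. decreasing_value Y Q i))"

definition storage :: "real \<Rightarrow> nat set" where
  "storage N = {..<nat \<lfloor>2 powr N\<rfloor>}"

datatype conversion = Deterministic | Majorization

text \<open>The induced map \<open>W\<^sub>f\<close> on distributions is \<open>map_pmf f\<close>.\<close>

fun conversion_fidelity ::
  "conversion \<Rightarrow> 'a set \<Rightarrow> 'a pmf \<Rightarrow> 'b set \<Rightarrow> 'b pmf \<Rightarrow> real \<Rightarrow> real" where
  "conversion_fidelity Deterministic X P Y Q N =
     Sup {fidelity Y (map_pmf f' (map_pmf f P)) Q | f f'.
            f \<in> X \<rightarrow> storage N \<and> f' \<in> storage N \<rightarrow> Y}"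
| "conversion_fidelity Majorization X P Y Q N =
     Sup {fidelity Y P'' Q | P''.
            P'' \<in> distributions_on Y \<and>
            (\<exists>P'\<in>distributions_on (storage N).
               majorized X P (storage N) P' \<and> majorized (storage N) P' Y P'')}"

definition words :: "nat \<Rightarrow> (nat \<Rightarrow> 'a) set" where
  "words n = {..<n} \<rightarrow>\<^sub>E UNIV"

definition iid :: "nat \<Rightarrow> 'a pmf \<Rightarrow> (nat \<Rightarrow> 'a) pmf" where
  "iid n P = Pi_pmf {..<n} undefined (\<lambda>_. P)"

text \<open>
  \<open>iid_fidelity i P n Q t N\<close> is the maximal fidelity of converting \<open>n\<close> copies of \<open>P\<close> into \<open>t\<close>
  copies of \<open>Q\<close> through \<open>N\<close> bits. Negative \<open>t\<close> or \<open>N\<close>, for which the value is irrelevant, occur for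
  only finitely many \<open>n\<close> in the limits below.
\<close>

definition iid_fidelity ::
  "conversion \<Rightarrow> 'a pmf \<Rightarrow> nat \<Rightarrow> 'b pmf \<Rightarrow> real \<Rightarrow> real \<Rightarrow> real" where
  "iid_fidelity i P n Q t N =
     conversion_fidelity i (words n) (iid n P) (words (nat \<lfloor>t\<rfloor>)) (iid (nat \<lfloor>t\<rfloor>) Q) N"

definition achievable ::
  "conversion \<Rightarrow> real \<Rightarrow> 'a::finite pmf \<Rightarrow> 'b::finite pmf \<Rightarrow> real \<times> real \<Rightarrow> bool" where
  "achievable i \<nu> P Q = (\<lambda>(s\<^sub>1, t\<^sub>1). s\<^sub>1 > 0 \<and> t\<^sub>1 > 0 \<and>
     liminf (\<lambda>n. ereal (iid_fidelity i P n Q (t\<^sub>1 * real n) (s\<^sub>1 * real n))) \<ge> ereal \<nu>)"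

definition dominates :: "real \<times> real \<Rightarrow> real \<times> real \<Rightarrow> bool" where
  "dominates = (\<lambda>(s, t) (s', t'). s \<le> s' \<and> t \<ge> t')"

definition simulates :: "real \<times> real \<Rightarrow> real \<times> real \<Rightarrow> bool" where
  "simulates = (\<lambda>(s, t) (s', t'). s' / s = t' / t \<and> t' / t \<le> 1)"

definition semi_admissible ::
  "conversion \<Rightarrow> real \<Rightarrow> 'a::finite pmf \<Rightarrow> 'b::finite pmf \<Rightarrow> real \<times> real \<Rightarrow> bool" where
  "semi_admissible i \<nu> P Q r \<longleftrightarrow> achievable i \<nu> P Q r \<and>
     \<not> (\<exists>r'. r' \<noteq> r \<and> achievable i \<nu> P Q r' \<and> dominates r' r)"

definition admissible ::
  "conversion \<Rightarrow> real \<Rightarrow> 'a::finite pmf \<Rightarrow> 'b::finite pmf \<Rightarrow> real \<times> real \<Rightarrow> bool" where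
  "admissible i \<nu> P Q r \<longleftrightarrow> achievable i \<nu> P Q r \<and>
     \<not> (\<exists>r'. r' \<noteq> r \<and> achievable i \<nu> P Q r' \<and> (dominates r' r \<or> simulates r' r))"

definition second_order_fidelity ::
  "conversion \<Rightarrow> 'a::finite pmf \<Rightarrow> 'b::finite pmf \<Rightarrow> real \<Rightarrow> real \<Rightarrow> real \<Rightarrow> ereal" where
  "second_order_fidelity i P Q s\<^sub>1 s\<^sub>2 t\<^sub>2 =
     liminf (\<lambda>n. ereal (iid_fidelity i P n Q
       (s\<^sub>1 / shannon_entropy Q * real n + t\<^sub>2 * sqrt (real n))
       (s\<^sub>1 * real n + s\<^sub>2 * sqrt (real n))))"

text \<open>The closed form of the second-order limit; it does not depend on the source distribution.\<close>

definition limit_fidelity :: "'b::finite pmf \<Rightarrow> real \<Rightarrow> real \<Rightarrow> real \<Rightarrow> real" where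
  "limit_fidelity Q s\<^sub>1 s\<^sub>2 t\<^sub>2 =
     sqrt (Phi (sqrt (shannon_entropy Q / (varentropy Q * s\<^sub>1)) * (s\<^sub>2 - shannon_entropy Q * t\<^sub>2)))"

end

theory Submission
  imports Defs "HOL-Real_Asymp.Real_Asymp"
begin

text \<open>
  For \<open>0 < s\<^sub>1 < H(P)\<close> the storage is the only bottleneck. If \<open>P' \<prec> P''\<close> with \<open>P'\<close> supported on \<open>M\<close> points,
  then \<open>P''\<close> is supported on \<open>M\<close> points, so by Cauchy--Schwarz its fidelity with \<open>Q\<^sup>m\<close> is at most the
  square root of the largest \<open>Q\<^sup>m\<close>-mass of \<open>M\<close> points. Conversely, the typical words of \<open>P\<^sup>n\<close> have
  mass far below \<open>1 / M\<close>, so a greedy map simulates \<open>Q\<^sup>m\<close> conditioned on its \<open>M\<close> likeliest words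
  almost perfectly, and that conditional distribution attains the same square root. The \<open>Q\<^sup>m\<close>-mass
  of the likeliest \<open>2\<^sup>N\<close> words is, up to a vanishing error, the probability that the surprisal is
  at most \<open>N\<close>, which the central limit theorem evaluates. Coarse graining realises majorization, so the
  upper bound for majorization and the lower bound for deterministic maps settle both cases.
\<close>

section \<open>The normal distribution function and i.i.d. sums\<close>

text \<open>The normal density is positive everywhere, so a null interval \<open>{x<..y}\<close>
  would also be Lebesgue null, which its positive length excludes.\<close>

lemma Phi_strict_mono: "strict_mono Phi"
proof (rule strict_monoI)
  fix x y :: real assume "x < y"
  interpret real_distribution std_normal_distribution by (rule real_dist_normal_dist)
  have "emeasure std_normal_distribution {x<..y} \<noteq> 0"
  proof
    assume "emeasure std_normal_distribution {x<..y} = 0"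
    then have "AE z in lborel. ennreal (std_normal_density z) * indicator {x<..y} z = 0"
      by (subst (asm) emeasure_density, simp, simp, subst (asm) nn_integral_0_iff_AE) auto
    then have "AE z in lborel. z \<notin> {x<..y}"
    proof eventually_elim
      case (elim z)
      then show ?case
        using normal_density_pos[of 1 0 z] by (auto simp: indicator_def split: if_splits)
    qed
    then have "emeasure lborel {x<..y} = 0"
      by (subst (asm) AE_iff_measurable[of "{x<..y}"]) auto
    then show False using \<open>x < y\<close> by simp
  qed
  then have "0 < measure std_normal_distribution {x<..y}"
    by (simp add: emeasure_eq_measure zero_less_measure_iff)
  then show "Phi x < Phi y"
    using cdf_diff_eq[OF \<open>x < y\<close>] by (simp add: Phi_def)
qed

lemma isCont_Phi: "isCont Phi x"
proof -
  interpret real_distribution std_normal_distribution by (rule real_dist_normal_dist)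
  have "emeasure std_normal_distribution {x} = 0"
    by (subst emeasure_density) (auto simp: nn_integral_0_iff_AE intro: AE_I[of _ _ "{x}"])
  then have "measure std_normal_distribution {x} = 0" by (simp add: measure_def)
  then have "isCont (cdf std_normal_distribution) x" using isCont_cdf by simp
  then show ?thesis unfolding Phi_def[abs_def] .
qed

text \<open>Strict monotonicity turns the weak bounds at \<open>x - 1\<close> and
  \<open>x + 1\<close> into strict ones at \<open>x\<close>. Positivity later ensures that the set
  of likely target words is eventually nonempty.\<close>

lemma Phi_bounds: "0 < Phi x" "Phi x < 1"
proof -
  interpret real_distribution std_normal_distribution by (rule real_dist_normal_dist)
  have "0 \<le> Phi (x - 1)" "Phi (x + 1) \<le> 1"
    by (auto simp: Phi_def cdf_nonneg cdf_bounded_prob)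
  moreover have "Phi (x - 1) < Phi x" "Phi x < Phi (x + 1)"
    using Phi_strict_mono by (auto simp: strict_mono_def)
  ultimately show "0 < Phi x" "Phi x < 1" by linarith+
qed

section \<open>Words of fixed length as marginals of an infinite i.i.d. sequence\<close>

lemma finite_words [simp]: "finite (words n :: (nat \<Rightarrow> 'a::finite) set)"
  by (auto simp: words_def intro: finite_PiE)

lemma set_pmf_iid: "set_pmf (iid n P) \<subseteq> words n"
  using set_Pi_pmf_subset[of "{..<n}" undefined "\<lambda>_. P"] by (force simp: iid_def words_def)

lemma pmf_iid: "w \<in> words n \<Longrightarrow> pmf (iid n P) w = (\<Prod>i<n. pmf P (w i))"
  by (auto simp: iid_def pmf_Pi words_def PiE_def extensional_def)

text \<open>The central limit theorem concerns one infinite sequence on one space, whereas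
  \<open>iid n Q\<close> lives on a space that changes with \<open>n\<close>. An event about the
  first \<open>n\<close> letters is a finite disjoint union of cylinders \<open>?C w\<close>, and
  each cylinder has the product probability of its word.\<close>

lemma prob_iid_eq_PiM:
  fixes Q :: "'b::finite pmf"
  assumes "E \<subseteq> words n"
  shows "measure (iid n Q) E =
    measure (PiM UNIV (\<lambda>_::nat. measure_pmf Q)) {\<omega>. restrict \<omega> {..<n} \<in> E}"
proof -
  let ?M = "PiM UNIV (\<lambda>_::nat. measure_pmf Q)"
  let ?C = "\<lambda>w. {\<omega>. \<forall>i\<in>{..<n}. \<omega> i \<in> {w i}}"
  interpret product_prob_space "\<lambda>_::nat. measure_pmf Q" UNIV
    by unfold_locales
  interpret prob_space ?M by (rule P.prob_space_axioms)
  have fin: "finite E" using assms finite_words finite_subset by blast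
  have sets: "?C w \<in> sets ?M" for w
  proof -
    have "?C w = {\<omega>\<in>space ?M. \<forall>i\<in>{..<n}. \<omega> i \<in> {w i}}" by (simp add: space_PiM)
    also have "\<dots> \<in> sets ?M" by measurable
    finally show ?thesis .
  qed
  have C: "measure ?M (?C w) = pmf (iid n Q) w" if "w \<in> E" for w
  proof -
    have "emeasure ?M (?C w) = (\<Prod>i\<in>{..<n}. emeasure (measure_pmf Q) {w i})"
      using emeasure_PiM_Collect[of "{..<n}" "\<lambda>i. {w i}"] by (simp add: space_PiM)
    also have "\<dots> = ennreal (pmf (iid n Q) w)"
      using that assms by (simp add: pmf_iid emeasure_pmf_single prod_ennreal subset_eq)
    finally show ?thesis by (simp add: measure_def)
  qed
  have "{\<omega>. restrict \<omega> {..<n} \<in> E} = (\<Union>w\<in>E. ?C w)"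
  proof (intro equalityI subsetI)
    fix \<omega> assume "\<omega> \<in> (\<Union>w\<in>E. ?C w)"
    then obtain w where w: "w \<in> E" "\<forall>i\<in>{..<n}. \<omega> i = w i" by auto
    then have "restrict \<omega> {..<n} = w"
      using assms by (auto simp: words_def PiE_def extensional_def restrict_def fun_eq_iff)
    with w show "\<omega> \<in> {\<omega>. restrict \<omega> {..<n} \<in> E}" by simp
  qed (auto intro!: bexI[of _ "restrict _ {..<n}"])
  moreover have "disjoint_family_on ?C E"
  proof (unfold disjoint_family_on_def, intro ballI impI)
    fix v w assume *: "v \<in> E" "w \<in> E" "v \<noteq> w"
    then obtain i where "v i \<noteq> w i" by (auto simp: fun_eq_iff)
    \<comment> \<open>Words take the value \<open>undefined\<close> from index \<open>n\<close> on,
      so two of them can differ only below \<open>n\<close>.\<close>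
    moreover have "i < n"
      using * \<open>v i \<noteq> w i\<close> assms by (auto simp: words_def PiE_def extensional_def subset_eq) metis
    ultimately show "?C v \<inter> ?C w = {}" by auto
  qed
  ultimately have "measure ?M {\<omega>. restrict \<omega> {..<n} \<in> E} = (\<Sum>w\<in>E. measure ?M (?C w))"
    using sets fin by (simp add: finite_measure_finite_Union image_subset_iff)
  also have "\<dots> = measure (iid n Q) E"
    unfolding measure_measure_pmf_finite[OF fin] by (intro sum.cong refl C)
  finally show ?thesis by simp
qed

lemma measure_pmf_cong_support:
  "(\<And>x. x \<in> set_pmf p \<Longrightarrow> x \<in> A \<longleftrightarrow> x \<in> B) \<Longrightarrow> measure (measure_pmf p) A = measure (measure_pmf p) B"
  by (intro measure_pmf.finite_measure_eq_AE) (auto simp: AE_measure_pmf_iff)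

lemma prob_iid_sum:
  fixes Q :: "'b::finite pmf" and g :: "'b \<Rightarrow> real"
  shows "measure (iid n Q) {w. R (\<Sum>i<n. g (w i))} =
    measure (PiM UNIV (\<lambda>_::nat. measure_pmf Q)) {\<omega>. R (\<Sum>i<n. g (\<omega> i))}"
proof -
  have "measure (iid n Q) {w. R (\<Sum>i<n. g (w i))} = measure (iid n Q) {w\<in>words n. R (\<Sum>i<n. g (w i))}"
    using set_pmf_iid[of n Q] by (intro measure_pmf_cong_support) auto
  also have "\<dots> = measure (PiM UNIV (\<lambda>_::nat. measure_pmf Q))
      {\<omega>. restrict \<omega> {..<n} \<in> {w\<in>words n. R (\<Sum>i<n. g (w i))}}"
    by (intro prob_iid_eq_PiM) auto
  also have "{\<omega>. restrict \<omega> {..<n} \<in> {w\<in>words n. R (\<Sum>i<n. g (w i))}} = {\<omega>. R (\<Sum>i<n. g (\<omega> i))}"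
    by (auto simp: words_def)
  finally show ?thesis .
qed

text \<open>The coordinates of the infinite product are independent copies of \<open>Q\<close>, so
  the central limit theorem applies to \<open>g\<close> of them. The limit law has no atoms, hence
  weak convergence gives convergence of the distribution functions at every
  \<open>x\<close>.\<close>

lemma iid_central_limit:
  fixes Q :: "'b::finite pmf" and g :: "'b \<Rightarrow> real"
  defines "\<mu> \<equiv> \<Sum>x\<in>UNIV. pmf Q x * g x"
  defines "v \<equiv> \<Sum>x\<in>UNIV. pmf Q x * (g x - \<mu>)\<^sup>2"
  assumes "v > 0"
  shows "(\<lambda>n. measure (iid n Q) {w. ((\<Sum>i<n. g (w i)) - real n * \<mu>) / sqrt (real n * v) \<le> x}) \<longlonglongrightarrow> Phi x"
proof -
  let ?M = "PiM UNIV (\<lambda>_::nat. measure_pmf Q)"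
  interpret product_prob_space "\<lambda>_::nat. measure_pmf Q" UNIV
    by unfold_locales
  interpret prob_space ?M by (rule P.prob_space_axioms)
  have meas [measurable]: "(\<lambda>\<omega>. g (\<omega> i)) \<in> borel_measurable ?M" for i
    by measurable
  have distr: "distr ?M borel (\<lambda>\<omega>. g (\<omega> i)) = distr (measure_pmf Q) borel g" for i
  proof -
    have "distr ?M borel (\<lambda>\<omega>. g (\<omega> i)) = distr (distr ?M (measure_pmf Q) (\<lambda>\<omega>. \<omega> i)) borel g"
      by (subst distr_distr) (auto simp: o_def)
    then show ?thesis by (simp add: PiM_component)
  qed
  \<comment> \<open>One change of variables serves twice: with the identity for the mean and with
    the squared deviation for the variance.\<close>
  have int: "integral\<^sup>L ?M (\<lambda>\<omega>. h (g (\<omega> i))) = (\<Sum>x\<in>UNIV. pmf Q x * h (g x))"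
    if [measurable]: "h \<in> borel_measurable borel" for h :: "real \<Rightarrow> real" and i
  proof -
    have "integral\<^sup>L ?M (\<lambda>\<omega>. h (g (\<omega> i))) = integral\<^sup>L (distr ?M borel (\<lambda>\<omega>. g (\<omega> i))) h"
      by (subst integral_distr) auto
    also have "\<dots> = integral\<^sup>L (measure_pmf Q) (\<lambda>x. h (g x))"
      by (subst distr, subst integral_distr) auto
    also have "\<dots> = (\<Sum>x\<in>UNIV. pmf Q x * h (g x))"
      by (subst integral_measure_pmf[of UNIV]) auto
    finally show ?thesis .
  qed
  have mean: "expectation (\<lambda>\<omega>. g (\<omega> i)) = \<mu>" for i
    using int[of "\<lambda>y. y"] by (simp add: \<mu>_def)
  have "weak_conv_m (\<lambda>n. distr ?M borel
      (\<lambda>\<omega>. (\<Sum>i<n. g (\<omega> i) - \<mu>) / sqrt (real n * (sqrt v)\<^sup>2))) std_normal_distribution"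
  proof (rule central_limit_theorem[where X = "\<lambda>i \<omega>. g (\<omega> i)" and m = \<mu> and \<sigma> = "sqrt v"
        and \<mu> = "distr (measure_pmf Q) borel g"])
    show "indep_vars (\<lambda>_. borel) (\<lambda>i \<omega>. g (\<omega> i)) UNIV"
    proof (rule indep_vars_compose2[where Y = "\<lambda>_. g" and X = "\<lambda>i \<omega>. \<omega> i"])
      show "indep_vars (\<lambda>_. measure_pmf Q) (\<lambda>i \<omega>. \<omega> i) UNIV"
        by (subst indep_vars_iff_distr_eq_PiM')
          (auto simp: PiM_component restrict_def intro!: PiM_cong distr_id2)
    qed auto
    show "expectation (\<lambda>\<omega>. g (\<omega> n)) = \<mu>" for n by (rule mean)
    show "0 < sqrt v" using \<open>v > 0\<close> by simp
    show "integrable ?M (\<lambda>\<omega>. (g (\<omega> n))\<^sup>2)" for n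
    proof (rule integrable_const_bound)
      show "AE \<omega> in ?M. norm ((g (\<omega> n))\<^sup>2) \<le> (\<Sum>x\<in>UNIV. (g x)\<^sup>2)"
        by (auto intro!: member_le_sum)
    qed measurable
    show "variance (\<lambda>\<omega>. g (\<omega> n)) = (sqrt v)\<^sup>2" for n
      unfolding mean using int[of "\<lambda>y. (y - \<mu>)\<^sup>2"] \<open>v > 0\<close> by (simp add: v_def)
    show "distr ?M borel (\<lambda>\<omega>. g (\<omega> n)) = distr (measure_pmf Q) borel g" for n
      by (rule distr)
  qed
  then have "(\<lambda>n. cdf (distr ?M borel
      (\<lambda>\<omega>. (\<Sum>i<n. g (\<omega> i) - \<mu>) / sqrt (real n * (sqrt v)\<^sup>2))) x) \<longlonglongrightarrow> Phi x"
    using isCont_Phi[of x] by (simp add: weak_conv_m_def weak_conv_def Phi_def[abs_def])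
  moreover have "cdf (distr ?M borel (\<lambda>\<omega>. (\<Sum>i<n. g (\<omega> i) - \<mu>) / sqrt (real n * (sqrt v)\<^sup>2))) x =
      measure (iid n Q) {w. ((\<Sum>i<n. g (w i)) - real n * \<mu>) / sqrt (real n * v) \<le> x}" for n
  proof -
    have "cdf (distr ?M borel (\<lambda>\<omega>. (\<Sum>i<n. g (\<omega> i) - \<mu>) / sqrt (real n * (sqrt v)\<^sup>2))) x =
        measure ?M {\<omega>. ((\<Sum>i<n. g (\<omega> i)) - real n * \<mu>) / sqrt (real n * v) \<le> x}"
      using \<open>v > 0\<close> unfolding cdf_def
      by (subst measure_distr) (auto simp: space_PiM sum_subtractf vimage_def)
    also have "\<dots> = measure (iid n Q) {w. ((\<Sum>i<n. g (w i)) - real n * \<mu>) / sqrt (real n * v) \<le> x}"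
      by (rule prob_iid_sum[symmetric])
    finally show ?thesis .
  qed
  ultimately show ?thesis by simp
qed

text \<open>The threshold moves with \<open>n\<close>, but it is eventually separated from any fixed
  \<open>y\<close> on either side of \<open>x\<close>. Monotonicity in the threshold, convergence at
  the fixed \<open>y\<close> and continuity of \<open>Phi\<close> then squeeze the limit.\<close>

lemma iid_central_limit_moving:
  fixes Q :: "'b::finite pmf" and g :: "'b \<Rightarrow> real" and m :: "nat \<Rightarrow> nat"
  defines "\<mu> \<equiv> \<Sum>x\<in>UNIV. pmf Q x * g x"
  defines "v \<equiv> \<Sum>x\<in>UNIV. pmf Q x * (g x - \<mu>)\<^sup>2"
  assumes "v > 0" and m: "filterlim m at_top sequentially"
    and c: "(\<lambda>n. (c n - real (m n) * \<mu>) / sqrt (real (m n) * v)) \<longlonglongrightarrow> x"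
  shows "(\<lambda>n. measure (iid (m n) Q) {w. (\<Sum>i<m n. g (w i)) \<le> c n}) \<longlonglongrightarrow> Phi x"
proof -
  let ?p = "\<lambda>n. measure (iid (m n) Q) {w. (\<Sum>i<m n. g (w i)) \<le> c n}"
  let ?q = "\<lambda>y n. measure (iid (m n) Q) {w. ((\<Sum>i<m n. g (w i)) - real (m n) * \<mu>) / sqrt (real (m n) * v) \<le> y}"
  have q: "?q y \<longlonglongrightarrow> Phi y" for y
    using filterlim_compose[OF iid_central_limit[of Q g y] m] \<open>v > 0\<close> by (simp add: \<mu>_def v_def)
  \<comment> \<open>For \<open>m n = 0\<close> the normalisation divides by zero and the two events
    may differ, so the rewriting is only claimed eventually.\<close>
  have pq: "eventually (\<lambda>n. ?p n = ?q ((c n - real (m n) * \<mu>) / sqrt (real (m n) * v)) n) sequentially"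
  proof -
    have "eventually (\<lambda>n. m n > 0) sequentially"
      using m[unfolded filterlim_at_top, rule_format, of 1] by eventually_elim simp
    then show ?thesis
    proof eventually_elim
      case (elim n)
      then have "sqrt (m n * v) > 0" using \<open>v > 0\<close> by simp
      then show ?case
        by (intro arg_cong[where f="measure _"]) (auto simp: divide_le_cancel)
    qed
  qed
  have mono: "?q y n \<le> ?q z n" if "y \<le> z" for y z n
    using that by (intro measure_pmf.finite_measure_mono) auto
  show ?thesis
  proof (rule order_tendstoI)
    fix a assume "a < Phi x"
    then obtain y where y: "y < x" "a < Phi y"
    proof -
      have "eventually (\<lambda>y. a < Phi y) (at_left x)"
        using isCont_Phi[of x] \<open>a < Phi x\<close>
        by (intro order_tendstoD) (auto simp: isCont_def filterlim_at_split)
      moreover have "eventually (\<lambda>y. y < x) (at_left x)"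
        by (simp add: eventually_at_filter)
      ultimately have "eventually (\<lambda>y. y < x \<and> a < Phi y) (at_left x)" by eventually_elim simp
      then obtain y where "y < x" "a < Phi y"
        using eventually_happens'[of "at_left x"] by auto
      then show ?thesis using that by blast
    qed
    show "eventually (\<lambda>n. a < ?p n) sequentially"
      using pq order_tendstoD(1)[OF q y(2)] order_tendstoD(1)[OF c y(1)]
    proof eventually_elim
      case (elim n)
      show ?case
        using elim mono[of y "(c n - real (m n) * \<mu>) / sqrt (real (m n) * v)" n] by linarith
    qed
  next
    fix a assume "Phi x < a"
    then obtain y where y: "x < y" "Phi y < a"
    proof -
      have "eventually (\<lambda>y. Phi y < a) (at_right x)"
        using isCont_Phi[of x] \<open>Phi x < a\<close>
        by (intro order_tendstoD) (auto simp: isCont_def filterlim_at_split)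
      moreover have "eventually (\<lambda>y. x < y) (at_right x)"
        by (simp add: eventually_at_filter)
      ultimately have "eventually (\<lambda>y. x < y \<and> Phi y < a) (at_right x)" by eventually_elim simp
      then obtain y where "x < y" "Phi y < a"
        using eventually_happens'[of "at_right x"] by auto
      then show ?thesis using that by blast
    qed
    show "eventually (\<lambda>n. ?p n < a) sequentially"
      using pq order_tendstoD(2)[OF q y(2)] order_tendstoD(2)[OF c y(1)]
    proof eventually_elim
      case (elim n)
      show ?case
        using elim mono[of "(c n - real (m n) * \<mu>) / sqrt (real (m n) * v)" y n] by linarith
    qed
  qed
qed

text \<open>On a finite alphabet \<open>g\<close> is bounded, so Hoeffding's inequality bounds the
  deviation probability by an exponentially small term.\<close>

lemma iid_weak_law:
  fixes P :: "'a::finite pmf" and g :: "'a \<Rightarrow> real"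
  defines "\<mu> \<equiv> \<Sum>x\<in>UNIV. pmf P x * g x"
  assumes "\<delta> > 0"
  shows "(\<lambda>n. measure (iid n P) {w. \<bar>(\<Sum>i<n. g (w i)) / real n - \<mu>\<bar> \<ge> \<delta>}) \<longlonglongrightarrow> 0"
proof -
  \<comment> \<open>The summand 1 keeps \<open>B\<close> positive even for \<open>g = 0\<close>,
    because Hoeffding's exponent divides by the squared length of the interval from
    \<open>-B\<close> to \<open>B\<close>.\<close>
  define B where "B = 1 + (\<Sum>x\<in>UNIV. \<bar>g x\<bar>)"
  have B: "\<bar>g x\<bar> \<le> B" for x
    using member_le_sum[of x UNIV "\<lambda>x. \<bar>g x\<bar>"] by (simp add: B_def)
  have "B > 0" by (simp add: B_def add_pos_nonneg sum_nonneg)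
  have distr: "distr (iid n P) borel (\<lambda>w. g (w i)) = distr (measure_pmf P) borel g" if "i < n" for i n
  proof -
    have "distr (iid n P) borel (\<lambda>w. g (w i)) = distr (measure_pmf (map_pmf (\<lambda>w. w i) (iid n P))) borel g"
      unfolding map_pmf_rep_eq by (subst distr_distr) (auto simp: o_def)
    also have "map_pmf (\<lambda>w. w i) (iid n P) = P"
      using that by (simp add: iid_def Pi_pmf_component)
    finally show ?thesis .
  qed
  have bound: "measure (iid n P) {w. \<bar>(\<Sum>i<n. g (w i)) / real n - \<mu>\<bar> \<ge> \<delta>}
      \<le> 2 * exp (-2 * real n * \<delta>\<^sup>2 / (B - (- B))\<^sup>2)" if "n > 0" for n
  proof -
    interpret Hoeffding_ineq_iid "iid n P" "{..<n}" "\<lambda>i w. g (w i)" "\<lambda>w. g (w 0)" "-B" B \<mu>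
    proof unfold_locales
      show "prob_space.indep_vars (measure_pmf (iid n P)) (\<lambda>_. borel) (\<lambda>i w. g (w i)) {..<n}"
        unfolding iid_def
        by (intro prob_space.indep_vars_compose2[OF _ indep_vars_Pi_pmf])
          (auto simp: measure_pmf.prob_space_axioms)
      have "measure_pmf.expectation (iid n P) (\<lambda>w. g (w 0)) =
          measure_pmf.expectation (map_pmf (\<lambda>w. w 0) (iid n P)) g" by simp
      also have "map_pmf (\<lambda>w. w 0) (iid n P) = P"
        using that by (simp add: iid_def Pi_pmf_component)
      also have "measure_pmf.expectation P g = \<mu>"
        by (subst integral_measure_pmf[of UNIV]) (auto simp: \<mu>_def)
      finally show "\<mu> \<equiv> measure_pmf.expectation (iid n P) (\<lambda>w. g (w 0))" by simp
      show "AE w in measure_pmf (iid n P). g (w 0) \<in> {- B..B}"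
        using B by (auto simp: abs_le_iff minus_le_iff)
    qed (use that in \<open>auto simp: distr\<close>)
    show ?thesis
      using Hoeffding_ineq_abs_ge'[of \<delta>] that \<open>\<delta> > 0\<close> \<open>B > 0\<close> by (auto simp: lessThan_empty_iff)
  qed
  have "(\<lambda>n. 2 * exp (-2 * real n * \<delta>\<^sup>2 / (B - (- B))\<^sup>2)) \<longlonglongrightarrow> 0"
  proof -
    have "(\<lambda>n. 2 * exp (- (2 * \<delta>\<^sup>2 / (B - (- B))\<^sup>2) * real n)) \<longlonglongrightarrow> 0"
      using \<open>\<delta> > 0\<close> \<open>B > 0\<close> by real_asymp
    then show ?thesis by (simp add: field_simps)
  qed
  then show ?thesis
  proof (rule tendsto_sandwich[OF _ _ tendsto_const, rotated 2])
    show "\<forall>\<^sub>F n in sequentially.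
        measure (iid n P) {w. \<delta> \<le> \<bar>(\<Sum>i<n. g (w i)) / real n - \<mu>\<bar>}
        \<le> 2 * exp (-2 * real n * \<delta>\<^sup>2 / (B - - B)\<^sup>2)"
      using eventually_gt_at_top[of 0] by eventually_elim (rule bound)
  qed simp
qed


section \<open>Majorization and fidelity\<close>

text \<open>Sorting points instead of values lets partial sums of \<open>decreasing_value\<close> be
  read as masses of sets.\<close>

lemma ex_decreasing_enumeration:
  assumes "finite X"
  obtains xs where "distinct xs" "set xs = X" "sorted_wrt (\<lambda>x y. pmf P y \<le> pmf P x) xs"
    "\<And>i. decreasing_value X P i = (if i < length xs then pmf P (xs ! i) else 0)"
proof -
  obtain zs where zs: "set zs = X" "distinct zs"
    using finite_distinct_list[OF assms] by blast
  define ys where "ys = sort_key (pmf P) zs"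
  have ys: "set ys = X" "distinct ys" "sorted (map (pmf P) ys)"
    using zs by (auto simp: ys_def)
  have "sorted_list_of_multiset (image_mset (pmf P) (mset_set X)) = map (pmf P) ys"
    using ys by (metis mset_map mset_set_set sort_key_id_if_sorted sorted_list_of_multiset_mset list.map_ident)
  then have "decreasing_value X P i = (if i < length (rev ys) then pmf P (rev ys ! i) else 0)" for i
    by (simp add: decreasing_value_def rev_map)
  moreover have "sorted_wrt (\<lambda>x y. pmf P y \<le> pmf P x) (rev ys)"
    using ys(3) by (simp add: sorted_wrt_rev sorted_map)
  ultimately show ?thesis
    using that[of "rev ys"] ys by simp
qed

text \<open>The first \<open>l\<close> points of the sorted enumeration attain the partial sum, and
  replacing points of a competitor \<open>C\<close> by points of that set never lowers the
  mass.\<close>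

lemma decreasing_sum:
  assumes "finite X"
  shows decreasing_sum_ge:
      "C \<subseteq> X \<Longrightarrow> card C \<le> l \<Longrightarrow> measure (measure_pmf P) C \<le> (\<Sum>i<l. decreasing_value X P i)"
    and decreasing_sum_attained:
      "\<exists>B\<subseteq>X. card B \<le> l \<and> measure (measure_pmf P) B = (\<Sum>i<l. decreasing_value X P i)"
proof -
  obtain xs where xs: "distinct xs" "set xs = X" "sorted_wrt (\<lambda>x y. pmf P y \<le> pmf P x) xs"
    and dv: "\<And>i. decreasing_value X P i = (if i < length xs then pmf P (xs ! i) else 0)"
    using ex_decreasing_enumeration[OF assms] by blast
  define B where "B = set (take l xs)"
  have "B \<subseteq> X" using xs set_take_subset[of l xs] by (auto simp: B_def)
  have card_B: "card B = min (length xs) l" using xs(1) by (simp add: B_def distinct_card)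
  have "(\<Sum>i<l. decreasing_value X P i) = (\<Sum>i<min (length xs) l. pmf P (xs ! i))"
    unfolding dv by (rule sum.mono_neutral_cong_right) auto
  also have "\<dots> = sum_list (map (pmf P) (take l xs))"
    by (simp add: sum_list_sum_nth atLeast0LessThan)
  also have "\<dots> = measure (measure_pmf P) B"
    using xs(1) by (simp add: B_def measure_measure_pmf_finite sum_list_distinct_conv_sum_set)
  finally have B: "(\<Sum>i<l. decreasing_value X P i) = measure (measure_pmf P) B" .
  show "\<exists>B\<subseteq>X. card B \<le> l \<and> measure (measure_pmf P) B = (\<Sum>i<l. decreasing_value X P i)"
    using \<open>B \<subseteq> X\<close> card_B B by (intro exI[of _ B]) simp
  show "measure (measure_pmf P) C \<le> (\<Sum>i<l. decreasing_value X P i)"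
    if C: "C \<subseteq> X" "card C \<le> l"
  proof (cases "l < length xs")
    case False
    then have "B = X" using xs by (simp add: B_def)
    with C show ?thesis unfolding B by (intro measure_pmf.finite_measure_mono) auto
  next
    case True
    define t where "t = pmf P (xs ! l)"
    have fin: "finite B" "finite C" using \<open>B \<subseteq> X\<close> C assms finite_subset by auto
    have ge: "t \<le> pmf P x" if "x \<in> B" for x
    proof -
      from that obtain i where "i < l" "x = xs ! i" by (auto simp: B_def in_set_conv_nth)
      then show ?thesis using xs(3) True by (simp add: t_def sorted_wrt_iff_nth_less)
    qed
    have le: "pmf P x \<le> t" if "x \<in> X - B" for x
    proof -
      from that xs obtain i where i: "i < length xs" "x = xs ! i" by (auto simp: in_set_conv_nth)
      have "l \<le> i"
      proof (rule ccontr)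
        assume "\<not> l \<le> i"
        then have "x \<in> B" using i by (auto simp: B_def in_set_conv_nth)
        with that show False by simp
      qed
      then show ?thesis using xs(3) i by (cases "l = i") (auto simp: t_def sorted_wrt_iff_nth_less)
    qed
    have "card (C - B) \<le> card (B - C)"
      using C card_B True fin by (simp add: card_Diff_subset_Int Int_commute)
    \<comment> \<open>exchange argument: \<open>t\<close> separates the values on \<open>B\<close> from those outside \<open>B\<close>\<close>
    have "(\<Sum>x\<in>C - B. pmf P x) \<le> (\<Sum>x\<in>C - B. t)"
      using C le by (intro sum_mono) auto
    also have "\<dots> \<le> (\<Sum>x\<in>B - C. t)"
      using \<open>card (C - B) \<le> card (B - C)\<close> by (simp add: t_def mult_right_mono)
    also have "\<dots> \<le> (\<Sum>x\<in>B - C. pmf P x)"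
      using ge by (intro sum_mono) auto
    finally have "(\<Sum>x\<in>C - B. pmf P x) \<le> (\<Sum>x\<in>B - C. pmf P x)" .
    then have "(\<Sum>x\<in>C. pmf P x) \<le> (\<Sum>x\<in>B. pmf P x)"
      using fin sum.Int_Diff[of B "pmf P" C] sum.Int_Diff[of C "pmf P" B]
      by (simp add: Int_commute)
    then show ?thesis unfolding B using fin by (simp add: measure_measure_pmf_finite)
  qed
qed

text \<open>Partial sums of sorted values are the largest masses of sets of bounded size. Stated
  with sets, majorization no longer mentions an ordering and combines directly with images of maps
  and with fidelity bounds.\<close>

lemma majorized_iff_subsets:
  assumes "finite X" "finite Y"
  shows "majorized X P Y Q \<longleftrightarrow> (\<forall>B\<subseteq>X. \<exists>C\<subseteq>Y. card C \<le> card B \<and>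
    measure (measure_pmf P) B \<le> measure (measure_pmf Q) C)"
proof (intro iffI allI impI)
  fix B assume "majorized X P Y Q" "B \<subseteq> X"
  have "measure (measure_pmf P) B \<le> (\<Sum>i<card B. decreasing_value X P i)"
    using \<open>B \<subseteq> X\<close> by (intro decreasing_sum_ge assms order_refl)
  also have "\<dots> \<le> (\<Sum>i<card B. decreasing_value Y Q i)"
    using \<open>majorized X P Y Q\<close> by (simp add: majorized_def)
  finally have "measure (measure_pmf P) B \<le> (\<Sum>i<card B. decreasing_value Y Q i)" .
  then show "\<exists>C\<subseteq>Y. card C \<le> card B \<and> measure (measure_pmf P) B \<le> measure (measure_pmf Q) C"
    using decreasing_sum_attained[OF assms(2), of "card B" Q] by metis
next
  assume *: "\<forall>B\<subseteq>X. \<exists>C\<subseteq>Y. card C \<le> card B \<and> measure (measure_pmf P) B \<le> measure (measure_pmf Q) C"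
  show "majorized X P Y Q"
    unfolding majorized_def
  proof
    fix l
    obtain B where B: "B \<subseteq> X" "card B \<le> l"
      "measure (measure_pmf P) B = (\<Sum>i<l. decreasing_value X P i)"
      using decreasing_sum_attained[OF assms(1)] by blast
    with * obtain C where C: "C \<subseteq> Y" "card C \<le> card B"
      "measure (measure_pmf P) B \<le> measure (measure_pmf Q) C" by blast
    then have "measure (measure_pmf Q) C \<le> (\<Sum>i<l. decreasing_value Y Q i)"
      using B by (intro decreasing_sum_ge assms) auto
    with B C show "(\<Sum>i<l. decreasing_value X P i) \<le> (\<Sum>i<l. decreasing_value Y Q i)" by simp
  qed
qed

lemma majorized_trans: "majorized X P Y Q \<Longrightarrow> majorized Y Q Z R \<Longrightarrow> majorized X P Z R"
  unfolding majorized_def using order_trans by blast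

lemma majorized_map_pmf:
  assumes "finite X" "finite Y" "f \<in> X \<rightarrow> Y"
  shows "majorized X P Y (map_pmf f P)"
  unfolding majorized_iff_subsets[OF assms(1,2)]
proof (intro allI impI)
  fix B assume "B \<subseteq> X"
  then have "f ` B \<subseteq> Y" "card (f ` B) \<le> card B"
    using assms by (auto intro: card_image_le finite_subset)
  moreover have "measure (measure_pmf P) B \<le> measure (measure_pmf (map_pmf f P)) (f ` B)"
    by (auto intro!: measure_pmf.finite_measure_mono)
  ultimately show "\<exists>C\<subseteq>Y. card C \<le> card B \<and>
      measure (measure_pmf P) B \<le> measure (measure_pmf (map_pmf f P)) C"
    by blast
qed

section \<open>Cauchy-Schwarz bounds on the fidelity\<close>

lemma fidelity_le_sqrt_mult:
  assumes "finite Y"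
  shows "fidelity Y P Q \<le> sqrt (measure (measure_pmf P) Y) * sqrt (measure (measure_pmf Q) Y)"
  using Cauchy_Schwarz_ineq_sum[of "\<lambda>y. sqrt (pmf P y)" "\<lambda>y. sqrt (pmf Q y)" Y] assms
  by (auto simp: fidelity_def measure_measure_pmf_finite simp flip: real_sqrt_mult intro!: real_le_rsqrt)

lemma fidelity_le_1: "finite Y \<Longrightarrow> fidelity Y P Q \<le> 1"
  by (rule order_trans[OF fidelity_le_sqrt_mult mult_le_one]) auto

text \<open>Split the sum at \<open>C\<close> and apply Cauchy-Schwarz to each half, bounding the
  mass of \<open>P\<close> by 1 on \<open>C\<close> and the mass of \<open>Q\<close> by 1
  outside.\<close>

lemma fidelity_le_subset:
  assumes "finite Y" "C \<subseteq> Y"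
  shows "fidelity Y P Q \<le> sqrt (measure (measure_pmf Q) C) + sqrt (1 - measure (measure_pmf P) C)"
proof -
  have "finite C" using assms finite_subset by blast
  have "fidelity Y P Q = fidelity C P Q + fidelity (Y - C) P Q"
    unfolding fidelity_def by (simp add: sum.subset_diff[OF assms(2,1)])
  moreover have "fidelity C P Q \<le> 1 * sqrt (measure (measure_pmf Q) C)"
    by (rule order_trans[OF fidelity_le_sqrt_mult[OF \<open>finite C\<close>] mult_right_mono]) auto
  moreover have "fidelity (Y - C) P Q \<le> sqrt (1 - measure (measure_pmf P) C) * 1"
  proof (rule order_trans[OF fidelity_le_sqrt_mult mult_mono])
    have "measure (measure_pmf P) (Y - C) \<le> measure (measure_pmf P) (UNIV - C)"
      by (intro measure_pmf.finite_measure_mono) auto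
    also have "\<dots> = 1 - measure (measure_pmf P) C"
      using measure_pmf.prob_compl[of C P] by simp
    finally show "sqrt (measure (measure_pmf P) (Y - C)) \<le> sqrt (1 - measure (measure_pmf P) C)"
      by simp
  qed (use assms in auto)
  ultimately show ?thesis by simp
qed

text \<open>Points of \<open>C\<close> below the threshold contribute at most \<theta> each, and the
  others lie in the threshold set. This bounds the mass of the likeliest few points by the law of
  the surprisal, without sorting.\<close>

lemma measure_pmf_le_threshold:
  fixes \<theta> :: real
  assumes "finite C" "0 \<le> \<theta>"
  shows "measure (measure_pmf Q) C \<le> measure (measure_pmf Q) {y. \<theta> \<le> pmf Q y} + real (card C) * \<theta>"
proof -
  have "measure (measure_pmf Q) C \<le> measure (measure_pmf Q) ({y. \<theta> \<le> pmf Q y} \<union> {y\<in>C. pmf Q y < \<theta>})"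
    by (intro measure_pmf.finite_measure_mono) auto
  also have "\<dots> \<le> measure (measure_pmf Q) {y. \<theta> \<le> pmf Q y} + measure (measure_pmf Q) {y\<in>C. pmf Q y < \<theta>}"
    by (intro measure_Un_le) auto
  also have "measure (measure_pmf Q) {y\<in>C. pmf Q y < \<theta>} \<le> real (card {y\<in>C. pmf Q y < \<theta>}) * \<theta>"
    using assms(1) by (subst measure_measure_pmf_finite) (auto intro!: sum_bounded_above)
  also have "\<dots> \<le> real (card C) * \<theta>"
    using assms by (auto intro!: mult_right_mono card_mono)
  finally show ?thesis by simp
qed

section \<open>One-shot bounds\<close>

lemma finite_storage [simp]: "finite (storage N)"
  by (simp add: storage_def)

lemma card_storage_le: "real (card (storage N)) \<le> 2 powr N"
  by (simp add: storage_def)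

lemma storage_nonempty: "0 \<le> N \<Longrightarrow> storage N \<noteq> {}"
  using ge_one_powr_ge_zero[of 2 N] by (auto simp: storage_def lessThan_empty_iff)

text \<open>A coarse graining majorizes its source, so one pair of maps is a candidate in both
  suprema. That fidelities are at most 1 supplies the boundedness that \<open>Sup\<close> on the
  reals requires.\<close>

lemma conversion_fidelity_ge:
  assumes "finite X" "finite Y" "P \<in> distributions_on X"
    and f: "f \<in> X \<rightarrow> storage N" "f' \<in> storage N \<rightarrow> Y"
  shows "fidelity Y (map_pmf f' (map_pmf f P)) Q \<le> conversion_fidelity i X P Y Q N"
proof (cases i)
  case Deterministic
  show ?thesis
    unfolding Deterministic conversion_fidelity.simps
    using f by (intro cSup_upper bdd_aboveI[of _ 1]) (auto intro: fidelity_le_1[OF assms(2)])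
next
  case Majorization
  have "map_pmf f P \<in> distributions_on (storage N)"
    "map_pmf f' (map_pmf f P) \<in> distributions_on Y"
    using assms by (auto simp: distributions_on_def Pi_iff subset_eq)
  moreover have "majorized X P (storage N) (map_pmf f P)"
    "majorized (storage N) (map_pmf f P) Y (map_pmf f' (map_pmf f P))"
    using assms by (auto intro!: majorized_map_pmf finite_storage)
  ultimately show ?thesis
    unfolding Majorization conversion_fidelity.simps
    by (intro cSup_upper bdd_aboveI[of _ 1]) (use fidelity_le_1[OF assms(2)] in blast)+
qed

text \<open>The values \<open>D\<close> attained by maps are among the values \<open>M\<close>
  attained by majorization, so a bound on \<open>M\<close> covers both cases. The nonempty storage
  and target provide constant maps, and thereby nonempty sets for \<open>Sup\<close>.\<close>

lemma conversion_fidelity_le: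
  assumes "finite X" "finite Y" "P \<in> distributions_on X" "storage N \<noteq> {}" "Y \<noteq> {}"
    and bound: "\<And>P' P''. P' \<in> distributions_on (storage N) \<Longrightarrow> P'' \<in> distributions_on Y \<Longrightarrow>
      majorized X P (storage N) P' \<Longrightarrow> majorized (storage N) P' Y P'' \<Longrightarrow> fidelity Y P'' Q \<le> b"
  shows "conversion_fidelity i X P Y Q N \<le> b"
proof -
  obtain s y where sy: "s \<in> storage N" "y \<in> Y" using assms by blast
  define D where "D = {fidelity Y (map_pmf f' (map_pmf f P)) Q | f f'.
            f \<in> X \<rightarrow> storage N \<and> f' \<in> storage N \<rightarrow> Y}"
  define M where "M = {fidelity Y P'' Q | P''. P'' \<in> distributions_on Y \<and>
            (\<exists>P'\<in>distributions_on (storage N).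
               majorized X P (storage N) P' \<and> majorized (storage N) P' Y P'')}"
  have "D \<noteq> {}" unfolding D_def using sy by (auto intro!: exI[of _ "\<lambda>_. s"] exI[of _ "\<lambda>_. y"])
  have "D \<subseteq> M"
    unfolding D_def M_def
  proof clarify
    fix f f' assume f: "f \<in> X \<rightarrow> storage N" "f' \<in> storage N \<rightarrow> Y"
    then have "map_pmf f P \<in> distributions_on (storage N)"
      "map_pmf f' (map_pmf f P) \<in> distributions_on Y"
      using assms by (auto simp: distributions_on_def Pi_iff subset_eq)
    with f assms(1,2) show "\<exists>P''. fidelity Y (map_pmf f' (map_pmf f P)) Q = fidelity Y P'' Q \<and>
        P'' \<in> distributions_on Y \<and> (\<exists>P'\<in>distributions_on (storage N).
               majorized X P (storage N) P' \<and> majorized (storage N) P' Y P'')"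
      by (metis majorized_map_pmf finite_storage)
  qed
  have M: "x \<le> b" if "x \<in> M" for x using that bound unfolding M_def by blast
  have "M \<noteq> {}" using \<open>D \<noteq> {}\<close> \<open>D \<subseteq> M\<close> by blast
  then have "Sup M \<le> b" using M by (rule cSup_least)
  moreover have "Sup D \<le> b"
    using \<open>D \<noteq> {}\<close> by (rule cSup_least) (use \<open>D \<subseteq> M\<close> M in blast)
  ultimately show ?thesis by (cases i) (simp_all add: D_def M_def)
qed

text \<open>Applied to the whole storage, majorization yields a set \<open>C\<close> of at most
  \<open>2 powr N\<close> points with full mass under \<open>P''\<close>. The second term of
  \<open>fidelity_le_subset\<close> vanishes, and the threshold bound controls the mass of
  \<open>C\<close> under \<open>Q\<close>.\<close>

lemma conversion_fidelity_le_storage: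
  fixes \<theta> :: real
  assumes "finite X" "finite Y" "P \<in> distributions_on X" "storage N \<noteq> {}" "Y \<noteq> {}" "0 \<le> \<theta>"
  shows "conversion_fidelity i X P Y Q N \<le>
    sqrt (measure (measure_pmf Q) {y. \<theta> \<le> pmf Q y} + 2 powr N * \<theta>)"
proof (rule conversion_fidelity_le[OF assms(1-5)])
  fix P' P''
  assume P': "P' \<in> distributions_on (storage N)" and maj: "majorized (storage N) P' Y P''"
  have "measure (measure_pmf P') (storage N) = 1"
    using P' by (auto simp: distributions_on_def measure_pmf.prob_eq_1 AE_measure_pmf_iff)
  with maj obtain C where C: "C \<subseteq> Y" "card C \<le> card (storage N)" "measure (measure_pmf P'') C = 1"
    unfolding majorized_iff_subsets[OF finite_storage assms(2)]
    by (metis order_refl measure_pmf.prob_le_1 order_antisym)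
  have "fidelity Y P'' Q \<le> sqrt (measure (measure_pmf Q) C)"
    using fidelity_le_subset[OF assms(2) C(1), of P'' Q] C(3) by simp
  also have "\<dots> \<le> sqrt (measure (measure_pmf Q) {y. \<theta> \<le> pmf Q y} + 2 powr N * \<theta>)"
  proof (intro real_sqrt_le_mono)
    have "measure (measure_pmf Q) C \<le> measure (measure_pmf Q) {y. \<theta> \<le> pmf Q y} + real (card C) * \<theta>"
      using C(1) assms finite_subset by (intro measure_pmf_le_threshold) auto
    moreover have "real (card C) \<le> 2 powr N"
      using C(2) card_storage_le[of N] by linarith
    then have "real (card C) * \<theta> \<le> 2 powr N * \<theta>"
      using assms(6) by (intro mult_right_mono)
    ultimately show "measure (measure_pmf Q) C
        \<le> measure (measure_pmf Q) {y. \<theta> \<le> pmf Q y} + 2 powr N * \<theta>" by linarith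
  qed
  finally show "fidelity Y P'' Q \<le> sqrt (measure (measure_pmf Q) {y. \<theta> \<le> pmf Q y} + 2 powr N * \<theta>)" .
qed

text \<open>By transitivity \<open>P''\<close> majorizes \<open>P\<close> itself, so
  \<open>P''\<close> is at least as concentrated on few points as \<open>P\<close> is on
  \<open>A\<close>. With \<open>A\<close> a small set of large mass this gives the first-order
  converse, whatever the storage size.\<close>

lemma conversion_fidelity_le_source:
  fixes \<theta> :: real
  assumes "finite X" "finite Y" "P \<in> distributions_on X" "storage N \<noteq> {}" "Y \<noteq> {}" "0 \<le> \<theta>"
    and A: "A \<subseteq> X"
  shows "conversion_fidelity i X P Y Q N \<le>
    sqrt (measure (measure_pmf Q) {y. \<theta> \<le> pmf Q y} + real (card A) * \<theta>) + sqrt (1 - measure (measure_pmf P) A)"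
proof (rule conversion_fidelity_le[OF assms(1-5)])
  fix P' P''
  assume "majorized X P (storage N) P'" "majorized (storage N) P' Y P''"
  then have "majorized X P Y P''" by (rule majorized_trans)
  with A obtain C where C: "C \<subseteq> Y" "card C \<le> card A"
      "measure (measure_pmf P) A \<le> measure (measure_pmf P'') C"
    unfolding majorized_iff_subsets[OF assms(1,2)] by blast
  have "fidelity Y P'' Q \<le> sqrt (measure (measure_pmf Q) C) + sqrt (1 - measure (measure_pmf P'') C)"
    by (rule fidelity_le_subset[OF assms(2) C(1)])
  also have "\<dots> \<le> sqrt (measure (measure_pmf Q) {y. \<theta> \<le> pmf Q y} + real (card A) * \<theta>)
      + sqrt (1 - measure (measure_pmf P) A)"
  proof (intro add_mono real_sqrt_le_mono)
    have "measure (measure_pmf Q) C \<le> measure (measure_pmf Q) {y. \<theta> \<le> pmf Q y} + real (card C) * \<theta>"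
      using C(1) assms finite_subset by (intro measure_pmf_le_threshold) auto
    moreover have "real (card C) * \<theta> \<le> real (card A) * \<theta>"
      using C(2) assms(6) by (intro mult_right_mono) auto
    ultimately show "measure (measure_pmf Q) C
        \<le> measure (measure_pmf Q) {y. \<theta> \<le> pmf Q y} + real (card A) * \<theta>" by linarith
    show "1 - measure (measure_pmf P'') C \<le> 1 - measure (measure_pmf P) A"
      using C(3) by simp
  qed
  finally show "fidelity Y P'' Q \<le> sqrt (measure (measure_pmf Q) {y. \<theta> \<le> pmf Q y} + real (card A) * \<theta>)
      + sqrt (1 - measure (measure_pmf P) A)" .
qed

section \<open>Simulating a target distribution by a deterministic map\<close>

text \<open>
  Send points of \<open>A\<close> one by one to any target that still has room. When some point no longer fits,
  every target is filled up to less than \<open>\<epsilon>\<close>.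
\<close>

lemma ex_greedy_assignment:
  fixes p :: "'a \<Rightarrow> real" and R :: "'b \<Rightarrow> real" and \<epsilon> :: real
  assumes "finite A" "finite S" "\<And>x. x \<in> A \<Longrightarrow> 0 \<le> p x \<and> p x \<le> \<epsilon>" "\<And>y. y \<in> S \<Longrightarrow> 0 \<le> R y"
  shows "\<exists>g A'. A' \<subseteq> A \<and> g \<in> A' \<rightarrow> S \<and> (\<forall>y\<in>S. (\<Sum>x\<in>{x\<in>A'. g x = y}. p x) \<le> R y) \<and>
    min (\<Sum>x\<in>A. p x) ((\<Sum>y\<in>S. R y) - real (card S) * \<epsilon>) \<le> (\<Sum>x\<in>A'. p x)"
  using assms(1,3)
proof (induction A rule: finite_induct)
  case empty
  show ?case using assms(4) by (intro exI[of _ undefined] exI[of _ "{}"]) auto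
next
  case (insert a A)
  then obtain g A' where g: "A' \<subseteq> A" "g \<in> A' \<rightarrow> S" "\<forall>y\<in>S. (\<Sum>x\<in>{x\<in>A'. g x = y}. p x) \<le> R y"
    "min (\<Sum>x\<in>A. p x) ((\<Sum>y\<in>S. R y) - real (card S) * \<epsilon>) \<le> (\<Sum>x\<in>A'. p x)"
    by auto
  have "finite A'" "a \<notin> A'" using g(1) insert finite_subset by auto
  have pa: "0 \<le> p a" "p a \<le> \<epsilon>" using insert.prems by auto
  show ?case
  proof (cases "\<exists>y\<in>S. (\<Sum>x\<in>{x\<in>A'. g x = y}. p x) + p a \<le> R y")
    case True
    then obtain z where z: "z \<in> S" "(\<Sum>x\<in>{x\<in>A'. g x = z}. p x) + p a \<le> R z" by blast
    have eq: "{x \<in> insert a A'. (g(a := z)) x = y} =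
        (if y = z then insert a {x\<in>A'. g x = y} else {x\<in>A'. g x = y})" for y
      using \<open>a \<notin> A'\<close> by auto
    have "\<forall>y\<in>S. (\<Sum>x\<in>{x\<in>insert a A'. (g(a := z)) x = y}. p x) \<le> R y"
      unfolding eq using z g(3) \<open>finite A'\<close> \<open>a \<notin> A'\<close> by (auto simp: add.commute)
    moreover have "g(a := z) \<in> insert a A' \<rightarrow> S" using g(2) z by auto
    moreover have "min (\<Sum>x\<in>insert a A. p x) ((\<Sum>y\<in>S. R y) - real (card S) * \<epsilon>) \<le> (\<Sum>x\<in>insert a A'. p x)"
      using g(4) pa insert(1,2) \<open>finite A'\<close> \<open>a \<notin> A'\<close> by (auto simp: min_def split: if_splits)
    ultimately show ?thesis using g(1) by (intro exI[of _ "g(a := z)"] exI[of _ "insert a A'"]) blast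
  next
    case False
    have "(\<Sum>y\<in>S. R y) - real (card S) * \<epsilon> = (\<Sum>y\<in>S. R y - \<epsilon>)" by (simp add: sum_subtractf)
    also have "\<dots> \<le> (\<Sum>y\<in>S. \<Sum>x\<in>{x\<in>A'. g x = y}. p x)"
      using False pa by (intro sum_mono) (force simp: not_le)
    also have "\<dots> = (\<Sum>x\<in>A'. p x)"
      using g(2) \<open>finite A'\<close> assms(2) by (intro sum.group) auto
    finally show ?thesis using g by (intro exI[of _ g] exI[of _ A']) auto
  qed
qed

text \<open>The greedy map aims at \<open>R\<close>, which is \<open>Q\<close> conditioned on
  \<open>S\<close>, and fills each \<open>y\<close> with mass \<open>a y\<close> at most
  \<open>R y\<close>. Then \<open>a y\<close> is bounded by the product of the square roots of the
  output mass and of \<open>R y\<close>. Since \<open>R\<close> is \<open>Q\<close> divided by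
  \<open>q\<close>, multiplying by \<open>sqrt q\<close> produces the fidelity terms.\<close>

lemma ex_map_fidelity_ge:
  fixes \<epsilon> :: real
  assumes "finite Y" "S \<subseteq> Y" "S \<noteq> {}" "finite A"
    and A: "\<And>x. x \<in> A \<Longrightarrow> pmf P x \<le> \<epsilon>" and pos: "\<And>y. y \<in> S \<Longrightarrow> 0 < pmf Q y"
    and "0 \<le> \<epsilon>"
  shows "\<exists>f. range f \<subseteq> S \<and> fidelity Y (map_pmf f P) Q \<ge>
    sqrt (measure (measure_pmf Q) S) * (measure (measure_pmf P) A - real (card S) * \<epsilon>)"
proof -
  have "finite S" using assms finite_subset by blast
  obtain z where "z \<in> S" using assms by blast
  define q where "q = measure (measure_pmf Q) S"
  have q: "q = (\<Sum>y\<in>S. pmf Q y)" using \<open>finite S\<close> by (simp add: q_def measure_measure_pmf_finite)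
  have "q > 0" unfolding q using pos \<open>finite S\<close> \<open>S \<noteq> {}\<close> by (intro sum_pos) auto
  define R where "R y = pmf Q y / q" for y
  have "(\<Sum>y\<in>S. R y) = 1" using \<open>q > 0\<close> q by (simp add: R_def flip: sum_divide_distrib)
  have "\<And>y. y \<in> S \<Longrightarrow> 0 \<le> R y" using \<open>q > 0\<close> by (simp add: R_def)
  with ex_greedy_assignment[OF \<open>finite A\<close> \<open>finite S\<close>, of "pmf P" \<epsilon> R] A
  obtain g A' where g: "A' \<subseteq> A" "g \<in> A' \<rightarrow> S" "\<forall>y\<in>S. (\<Sum>x\<in>{x\<in>A'. g x = y}. pmf P x) \<le> R y"
    "min (\<Sum>x\<in>A. pmf P x) ((\<Sum>y\<in>S. R y) - real (card S) * \<epsilon>) \<le> (\<Sum>x\<in>A'. pmf P x)"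
    by auto
  have "finite A'" using g(1) \<open>finite A\<close> finite_subset by blast
  \<comment> \<open>Points that the greedy assignment leaves out go to an arbitrary \<open>z\<close>
    in \<open>S\<close>, which can only increase the output masses.\<close>
  define f where "f x = (if x \<in> A' then g x else z)" for x
  define a where "a y = (\<Sum>x\<in>{x\<in>A'. g x = y}. pmf P x)" for y
  have a: "a y \<le> pmf (map_pmf f P) y" for y
  proof -
    have "a y = measure (measure_pmf P) {x\<in>A'. g x = y}"
      using \<open>finite A'\<close> by (simp add: a_def measure_measure_pmf_finite)
    also have "\<dots> \<le> measure (measure_pmf P) (f -` {y})"
      by (intro measure_pmf.finite_measure_mono) (auto simp: f_def)
    finally show ?thesis by (simp add: pmf_map)
  qed
  have a0: "0 \<le> a y" for y by (simp add: a_def sum_nonneg)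
  have "sqrt q * (measure (measure_pmf P) A - real (card S) * \<epsilon>) \<le> sqrt q * (\<Sum>x\<in>A'. pmf P x)"
  proof (intro mult_left_mono)
    \<comment> \<open>If the minimum is the mass of \<open>A\<close>, subtracting this nonnegative
      term only lowers it. Otherwise the minimum is \<open>1 - real (card S) * \<epsilon>\<close>,
      and the mass of \<open>A\<close> is at most 1.\<close>
    have "0 \<le> real (card S) * \<epsilon>" using \<open>0 \<le> \<epsilon>\<close> by auto
    then show "measure (measure_pmf P) A - real (card S) * \<epsilon> \<le> (\<Sum>x\<in>A'. pmf P x)"
      using g(4) measure_pmf.prob_le_1[of P A]
      unfolding \<open>(\<Sum>y\<in>S. R y) = 1\<close> measure_measure_pmf_finite[OF \<open>finite A\<close>] by linarith
  qed (simp add: q_def)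
  also have "(\<Sum>x\<in>A'. pmf P x) = (\<Sum>y\<in>S. a y)"
    unfolding a_def using g(2) \<open>finite A'\<close> \<open>finite S\<close> by (intro sum.group[symmetric]) auto
  also have "sqrt q * (\<Sum>y\<in>S. a y) \<le> (\<Sum>y\<in>S. sqrt (pmf (map_pmf f P) y) * sqrt (pmf Q y))"
    unfolding sum_distrib_left
  proof (intro sum_mono)
    fix y assume "y \<in> S"
    have "a y = sqrt (a y) * sqrt (a y)" using a0 by simp
    also have "\<dots> \<le> sqrt (pmf (map_pmf f P) y) * sqrt (R y)"
      using a[of y] g(3) \<open>y \<in> S\<close> a0 by (intro mult_mono) (auto simp: a_def)
    finally have "sqrt q * a y \<le> sqrt q * (sqrt (pmf (map_pmf f P) y) * sqrt (R y))"
      using \<open>q > 0\<close> by (intro mult_left_mono) auto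
    also have "\<dots> = sqrt (pmf (map_pmf f P) y) * sqrt (pmf Q y)"
      using \<open>q > 0\<close> by (simp add: R_def real_sqrt_divide)
    finally show "sqrt q * a y \<le> sqrt (pmf (map_pmf f P) y) * sqrt (pmf Q y)" .
  qed
  also have "\<dots> \<le> fidelity Y (map_pmf f P) Q"
    unfolding fidelity_def using assms by (intro sum_mono2) auto
  finally have "fidelity Y (map_pmf f P) Q \<ge> sqrt q * (measure (measure_pmf P) A - real (card S) * \<epsilon>)" .
  moreover have "range f \<subseteq> S" using g(2) \<open>z \<in> S\<close> by (auto simp: f_def)
  ultimately show ?thesis unfolding q_def by blast
qed

lemma card_pmf_ge_le:
  assumes "finite Y"
  shows "real (card {y\<in>Y. 2 powr - c \<le> pmf Q y}) \<le> 2 powr c"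
proof -
  have "real (card {y\<in>Y. 2 powr - c \<le> pmf Q y}) * 2 powr - c \<le> (\<Sum>y\<in>{y\<in>Y. 2 powr - c \<le> pmf Q y}. pmf Q y)"
    using sum_bounded_below[of "{y\<in>Y. 2 powr - c \<le> pmf Q y}" "2 powr - c" "pmf Q"] by simp
  also have "\<dots> \<le> 1"
    using assms by (simp flip: measure_measure_pmf_finite)
  finally show ?thesis by (simp add: powr_minus field_simps)
qed

text \<open>The likely set \<open>S\<close> has at most \<open>2 powr N'\<close> points and fits
  into the storage. Encode by the simulating map followed by a numbering \<open>e\<close> of
  \<open>S\<close>, and decode by inverting \<open>e\<close>, so that the storage costs nothing
  further.\<close>

lemma conversion_fidelity_ge_threshold:
  fixes Q :: "'b pmf" and \<epsilon> :: real
  assumes "finite X" "finite Y" "P \<in> distributions_on X" "finite A"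
    and A: "\<And>x. x \<in> A \<Longrightarrow> pmf P x \<le> \<epsilon>" and "0 \<le> \<epsilon>" "N' \<le> N"
  defines "S \<equiv> {y\<in>Y. 2 powr - N' \<le> pmf Q y}"
  assumes "S \<noteq> {}"
  shows "sqrt (measure (measure_pmf Q) S) * (measure (measure_pmf P) A - 2 powr N' * \<epsilon>)
    \<le> conversion_fidelity i X P Y Q N"
proof -
  have "finite S" "S \<subseteq> Y" using assms(2) by (auto simp: S_def)
  have pos: "0 < pmf Q y" if "y \<in> S" for y
    using that by (auto simp: S_def intro: less_le_trans[of _ "2 powr - N'"])
  have card_S: "real (card S) \<le> 2 powr N'"
    unfolding S_def by (rule card_pmf_ge_le[OF assms(2)])
  have "2 powr N' \<le> 2 powr N" using \<open>N' \<le> N\<close> by simp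
  with card_S have "real (card S) \<le> 2 powr N" by linarith
  \<comment> \<open>A cardinality is an integer, so the bound survives rounding the storage size
    down.\<close>
  then have "int (card S) \<le> \<lfloor>2 powr N\<rfloor>" by (simp add: le_floor_iff)
  then have sub: "{..<card S} \<subseteq> storage N" by (auto simp: storage_def)
  obtain e where e: "bij_betw e S {..<card S}"
    using ex_bij_betw_finite_nat[OF \<open>finite S\<close>] by (auto simp: atLeast0LessThan)
  obtain f where f: "range f \<subseteq> S" "fidelity Y (map_pmf f P) Q \<ge>
      sqrt (measure (measure_pmf Q) S) * (measure (measure_pmf P) A - real (card S) * \<epsilon>)"
    using ex_map_fidelity_ge[of Y S A P \<epsilon> Q] assms pos \<open>S \<subseteq> Y\<close> by blast
  obtain z where "z \<in> S" using \<open>S \<noteq> {}\<close> by blast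
  \<comment> \<open>The encoder never produces indices from \<open>card S\<close> on. The default
    \<open>z\<close> keeps the decoder inside \<open>Y\<close> there.\<close>
  define d where "d k = (if k < card S then inv_into S e k else z)" for k
  have d: "d k \<in> S" for k
    using e \<open>z \<in> S\<close> by (auto simp: d_def bij_betw_def intro!: inv_into_into)
  have "d (e y) = y" if "y \<in> S" for y
    using e that by (auto simp: d_def bij_betw_def)
  then have "d (e (f x)) = f x" for x using f(1) by blast
  then have "map_pmf d (map_pmf (e \<circ> f) P) = map_pmf f P" by (simp add: pmf.map_comp o_def)
  have "sqrt (measure (measure_pmf Q) S) * (measure (measure_pmf P) A - 2 powr N' * \<epsilon>)
      \<le> sqrt (measure (measure_pmf Q) S) * (measure (measure_pmf P) A - real (card S) * \<epsilon>)"
    using card_S \<open>0 \<le> \<epsilon>\<close> by (intro mult_left_mono diff_left_mono mult_right_mono) auto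
  also have "\<dots> \<le> fidelity Y (map_pmf d (map_pmf (e \<circ> f) P)) Q"
    using f(2) \<open>map_pmf d (map_pmf (e \<circ> f) P) = map_pmf f P\<close> by simp
  also have "\<dots> \<le> conversion_fidelity i X P Y Q N"
    using assms(1-3)
  proof (rule conversion_fidelity_ge)
    show "e \<circ> f \<in> X \<rightarrow> storage N"
      using bij_betwE[OF e] f(1) sub unfolding o_def by blast
    show "d \<in> storage N \<rightarrow> Y" using d \<open>S \<subseteq> Y\<close> by auto
  qed
  finally show ?thesis .
qed

section \<open>Asymptotics\<close>

lemma shannon_entropy_altdef: "shannon_entropy Q = (\<Sum>x\<in>UNIV. pmf Q x * - log 2 (pmf Q x))"
  by (simp add: shannon_entropy_def sum_negf)

lemma neg_pmf_log_nonneg: "0 \<le> pmf Q x * - log 2 (pmf Q x)"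
  by (cases "pmf Q x = 0") (auto simp: mult_nonneg_nonpos pmf_le_1 less_le)

lemma shannon_entropy_nonneg: "0 \<le> shannon_entropy Q"
  unfolding shannon_entropy_altdef by (intro sum_nonneg neg_pmf_log_nonneg)

text \<open>Entropy is a sum of nonnegative terms. If it vanishes, every letter has probability 0 or
  surprisal 0, and then the varentropy vanishes too.\<close>

lemma shannon_entropy_pos:
  assumes "varentropy Q > 0"
  shows "shannon_entropy Q > 0"
proof -
  have "shannon_entropy Q \<noteq> 0"
  proof
    assume H: "shannon_entropy Q = 0"
    then have "pmf Q x * - log 2 (pmf Q x) = 0" for x
      unfolding shannon_entropy_altdef
      by (intro sum_nonneg_0[of UNIV "\<lambda>x. pmf Q x * - log 2 (pmf Q x)"] neg_pmf_log_nonneg) auto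
    then have "varentropy Q = 0"
      unfolding varentropy_def H by (intro sum.neutral) auto
    with assms show False by simp
  qed
  then show ?thesis using shannon_entropy_nonneg[of Q] by simp
qed

text \<open>Logarithms turn the product into a sum of surprisals. The right-hand side is always
  positive, so the identity is claimed on the support only.\<close>

lemma pmf_iid_eq_powr:
  assumes "w \<in> set_pmf (iid n P)"
  shows "pmf (iid n P) w = 2 powr - (\<Sum>i<n. - log 2 (pmf P (w i)))"
proof -
  have eq: "pmf (iid n P) w = (\<Prod>i<n. pmf P (w i))"
    using assms set_pmf_iid[of n P] by (intro pmf_iid) auto
  have "pmf (iid n P) w > 0" using assms by (simp add: pmf_positive_iff)
  then have pos: "pmf P (w i) > 0" if "i < n" for i
    using that unfolding eq by (metis finite_lessThan lessThan_iff pmf_pos prod_zero_iff)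
  have "2 powr - (\<Sum>i<n. - log 2 (pmf P (w i))) = (\<Prod>i<n. 2 powr log 2 (pmf P (w i)))"
    by (simp add: powr_sum sum_negf)
  also have "\<dots> = (\<Prod>i<n. pmf P (w i))"
    using pos by (intro prod.cong) auto
  finally show ?thesis using eq by simp
qed

text \<open>Thresholds on word probabilities become thresholds on a sum of i.i.d. surprisals, to
  which the limit theorems apply. Words off the support carry no mass.\<close>

lemma prob_iid_typical:
  "measure (iid n P) {w. 2 powr - c \<le> pmf (iid n P) w} =
    measure (iid n P) {w. (\<Sum>i<n. - log 2 (pmf P (w i))) \<le> c}"
  by (intro measure_pmf_cong_support) (simp add: pmf_iid_eq_powr)

lemma iid_typical_central_limit:
  fixes Q :: "'b::finite pmf"
  assumes "varentropy Q > 0" "filterlim m at_top sequentially"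
    and "(\<lambda>n. (c n - real (m n) * shannon_entropy Q) / sqrt (real (m n) * varentropy Q)) \<longlonglongrightarrow> x"
  shows "(\<lambda>n. measure (iid (m n) Q) {w. 2 powr - c n \<le> pmf (iid (m n) Q) w}) \<longlonglongrightarrow> Phi x"
  unfolding prob_iid_typical
  using assms iid_central_limit_moving[of Q "\<lambda>x. - log 2 (pmf Q x)" m c x]
  unfolding varentropy_def shannon_entropy_altdef by simp

text \<open>Both limits compare with the same event \<open>?bad\<close>, that the surprisal per
  letter deviates from the entropy by at least \<delta>.\<close>

lemma iid_typical_weak_law:
  fixes P :: "'a::finite pmf"
  assumes "\<delta> > 0"
  shows iid_typical_lower:
      "(\<lambda>n. measure (iid n P) {w. 2 powr - (real n * (shannon_entropy P + \<delta>)) \<le> pmf (iid n P) w}) \<longlonglongrightarrow> 1"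
    and iid_typical_upper:
      "(\<lambda>n. measure (iid n P) {w. 2 powr - (real n * (shannon_entropy P - \<delta>)) \<le> pmf (iid n P) w}) \<longlonglongrightarrow> 0"
proof -
  let ?s = "\<lambda>n (w :: nat \<Rightarrow> 'a). \<Sum>i<n. - log 2 (pmf P (w i))"
  let ?bad = "\<lambda>n. measure (iid n P) {w. \<delta> \<le> \<bar>?s n w / real n - shannon_entropy P\<bar>}"
  have bad: "?bad \<longlonglongrightarrow> 0"
    using iid_weak_law[OF assms, of P "\<lambda>x. - log 2 (pmf P x)"] by (simp add: shannon_entropy_altdef)
  have low: "1 - ?bad n \<le> measure (iid n P) {w. ?s n w \<le> real n * (shannon_entropy P + \<delta>)}"
    if "n > 0" for n
  proof -
    have "1 - ?bad n = measure (iid n P) (UNIV - {w. \<delta> \<le> \<bar>?s n w / real n - shannon_entropy P\<bar>})"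
      using measure_pmf.prob_compl[of _ "iid n P"] by simp
    also have "\<dots> \<le> measure (iid n P) {w. ?s n w \<le> real n * (shannon_entropy P + \<delta>)}"
      using that by (intro measure_pmf.finite_measure_mono) (auto simp: abs_le_iff not_le field_simps)
    finally show ?thesis .
  qed
  show "(\<lambda>n. measure (iid n P) {w. 2 powr - (real n * (shannon_entropy P + \<delta>)) \<le> pmf (iid n P) w}) \<longlonglongrightarrow> 1"
    unfolding prob_iid_typical
  proof (rule tendsto_sandwich)
    show "(\<lambda>n. 1 - ?bad n) \<longlonglongrightarrow> 1" using tendsto_diff[OF tendsto_const bad, of 1] by simp
    show "\<forall>\<^sub>F n in sequentially. 1 - ?bad n \<le>
        measure (iid n P) {w. ?s n w \<le> real n * (shannon_entropy P + \<delta>)}"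
      using eventually_gt_at_top[of 0] by eventually_elim (rule low)
  qed auto
  have up: "measure (iid n P) {w. ?s n w \<le> real n * (shannon_entropy P - \<delta>)} \<le> ?bad n" if "n > 0" for n
    using that by (intro measure_pmf.finite_measure_mono) (auto simp: field_simps abs_if)
  show "(\<lambda>n. measure (iid n P) {w. 2 powr - (real n * (shannon_entropy P - \<delta>)) \<le> pmf (iid n P) w}) \<longlonglongrightarrow> 0"
    unfolding prob_iid_typical
  proof (rule tendsto_sandwich[OF _ _ tendsto_const bad])
    show "\<forall>\<^sub>F n in sequentially.
        measure (iid n P) {w. ?s n w \<le> real n * (shannon_entropy P - \<delta>)} \<le> ?bad n"
      using eventually_gt_at_top[of 0] by eventually_elim (rule up)
  qed auto
qed

section \<open>The one-shot bounds for i.i.d. sources and targets\<close>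

lemma iid_in_distributions_on: "iid n P \<in> distributions_on (words n)"
  using set_pmf_iid by (auto simp: distributions_on_def)

lemma words_nonempty: "words n \<noteq> {}"
  by (auto simp: words_def PiE_eq_empty_iff)

lemma prob_iid_words: "measure (iid n P) {w\<in>words n. R w} = measure (iid n P) {w. R w}"
  using set_pmf_iid[of n P] by (intro measure_pmf_cong_support) auto

text \<open>Keeping \<open>c\<close> separate from \<open>N\<close> leaves room: the correction
  \<open>2 powr (N - c)\<close> vanishes as soon as \<open>c\<close> exceeds \<open>N\<close> by a
  diverging amount.\<close>

lemma iid_fidelity_le_storage:
  fixes P :: "'a::finite pmf" and Q :: "'b::finite pmf" and t N c :: real
  defines "m \<equiv> nat \<lfloor>t\<rfloor>"
  assumes "0 \<le> N"
  shows "iid_fidelity i P n Q t N \<le>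
    sqrt (measure (iid m Q) {w. 2 powr - c \<le> pmf (iid m Q) w} + 2 powr (N - c))"
proof -
  have "iid_fidelity i P n Q t N \<le>
    sqrt (measure (iid m Q) {w. 2 powr - c \<le> pmf (iid m Q) w} + 2 powr N * 2 powr - c)"
    unfolding iid_fidelity_def m_def[symmetric]
    by (rule conversion_fidelity_le_storage)
      (use assms(2) in \<open>auto simp: iid_in_distributions_on storage_nonempty words_nonempty\<close>)
  then show ?thesis by (simp flip: powr_add)
qed

lemma iid_fidelity_le_source:
  fixes P :: "'a::finite pmf" and Q :: "'b::finite pmf" and t N c :: real
  defines "m \<equiv> nat \<lfloor>t\<rfloor>"
  assumes "0 \<le> N"
  shows "iid_fidelity i P n Q t N \<le>
    sqrt (measure (iid m Q) {w. 2 powr - c \<le> pmf (iid m Q) w} + 2 powr (d - c)) +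
    sqrt (1 - measure (iid n P) {w. 2 powr - d \<le> pmf (iid n P) w})"
proof -
  define A where "A = {w\<in>words n. 2 powr - d \<le> pmf (iid n P) w}"
  have "iid_fidelity i P n Q t N \<le>
    sqrt (measure (iid m Q) {w. 2 powr - c \<le> pmf (iid m Q) w} + real (card A) * 2 powr - c) +
    sqrt (1 - measure (iid n P) A)"
    unfolding iid_fidelity_def m_def[symmetric]
    by (rule conversion_fidelity_le_source)
      (use assms(2) in \<open>auto simp: A_def iid_in_distributions_on storage_nonempty words_nonempty\<close>)
  also have "measure (iid n P) A = measure (iid n P) {w. 2 powr - d \<le> pmf (iid n P) w}"
    unfolding A_def by (rule prob_iid_words)
  also have "sqrt (measure (iid m Q) {w. 2 powr - c \<le> pmf (iid m Q) w} + real (card A) * 2 powr - c)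
     \<le> sqrt (measure (iid m Q) {w. 2 powr - c \<le> pmf (iid m Q) w} + 2 powr (d - c))"
  proof -
    have "real (card A) * 2 powr - c \<le> 2 powr d * 2 powr - c"
      unfolding A_def by (intro mult_right_mono card_pmf_ge_le) auto
    then show ?thesis by (simp flip: powr_add)
  qed
  finally show ?thesis by simp
qed

text \<open>Here \<open>c\<close> selects the likely target words and \<open>d\<close> the unlikely
  source words. The loss \<open>2 powr (c - d)\<close> is the number of targets times the mass of a
  single source word, the granularity of the greedy map.\<close>

lemma iid_fidelity_ge:
  fixes P :: "'a::finite pmf" and Q :: "'b::finite pmf" and t N c d :: real
  defines "m \<equiv> nat \<lfloor>t\<rfloor>"
  assumes "c \<le> N" and pos: "0 < measure (iid m Q) {w. 2 powr - c \<le> pmf (iid m Q) w}"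
  shows "sqrt (measure (iid m Q) {w. 2 powr - c \<le> pmf (iid m Q) w}) *
      (1 - measure (iid n P) {w. 2 powr - d \<le> pmf (iid n P) w} - 2 powr (c - d))
    \<le> iid_fidelity i P n Q t N"
proof -
  define A where "A = {w\<in>words n. pmf (iid n P) w \<le> 2 powr - d}"
  have "0 < measure (iid m Q) {w\<in>words m. 2 powr - c \<le> pmf (iid m Q) w}"
    using pos unfolding prob_iid_words .
  then have "{w\<in>words m. 2 powr - c \<le> pmf (iid m Q) w} \<noteq> {}"
    by (metis less_irrefl measure_empty)
  then have "sqrt (measure (iid m Q) {w\<in>words m. 2 powr - c \<le> pmf (iid m Q) w}) *
      (measure (iid n P) A - 2 powr c * 2 powr - d) \<le> iid_fidelity i P n Q t N"
    unfolding iid_fidelity_def m_def[symmetric] using assms(2)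
    by (intro conversion_fidelity_ge_threshold) (auto simp: A_def iid_in_distributions_on)
  moreover have "1 - measure (iid n P) {w. 2 powr - d \<le> pmf (iid n P) w} \<le> measure (iid n P) A"
  proof -
    have "1 - measure (iid n P) {w. 2 powr - d \<le> pmf (iid n P) w} =
        measure (iid n P) (UNIV - {w. 2 powr - d \<le> pmf (iid n P) w})"
      using measure_pmf.prob_compl[of _ "iid n P"] by simp
    also have "\<dots> \<le> measure (iid n P) {w. pmf (iid n P) w \<le> 2 powr - d}"
      by (intro measure_pmf.finite_measure_mono) auto
    finally show ?thesis unfolding A_def prob_iid_words .
  qed
  then have "sqrt (measure (iid m Q) {w. 2 powr - c \<le> pmf (iid m Q) w}) *
      (1 - measure (iid n P) {w. 2 powr - d \<le> pmf (iid n P) w} - 2 powr (c - d)) \<le>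
      sqrt (measure (iid m Q) {w. 2 powr - c \<le> pmf (iid m Q) w}) *
      (measure (iid n P) A - 2 powr c * 2 powr - d)"
    by (intro mult_left_mono) (auto simp flip: powr_add)
  ultimately show ?thesis unfolding prob_iid_words by linarith
qed

lemma abs_nat_floor_diff_le: "0 \<le> x \<Longrightarrow> \<bar>real (nat \<lfloor>x\<rfloor>) - x\<bar> \<le> 1"
  by (simp add: abs_if) linarith

text \<open>The fidelity is squeezed between the one-shot bounds with threshold exponents
  \<open>N n\<close> and \<open>N n + ln (real n)\<close>. Both give the same limit, since the
  central limit theorem does not see shifts of smaller order than the square root of
  \<open>n\<close>.\<close>

lemma iid_fidelity_tendsto_second_order:
  fixes P :: "'a::finite pmf" and Q :: "'b::finite pmf" and s\<^sub>1 s\<^sub>2 t\<^sub>2 :: real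
  assumes V: "varentropy Q > 0" and s: "0 < s\<^sub>1" "s\<^sub>1 < shannon_entropy P"
  shows "(\<lambda>n. iid_fidelity i P n Q (s\<^sub>1 / shannon_entropy Q * real n + t\<^sub>2 * sqrt (real n))
      (s\<^sub>1 * real n + s\<^sub>2 * sqrt (real n))) \<longlonglongrightarrow> limit_fidelity Q s\<^sub>1 s\<^sub>2 t\<^sub>2"
proof -
  define h where "h = shannon_entropy Q"
  define v where "v = varentropy Q"
  have "h > 0" "v > 0" using V shannon_entropy_pos[OF V] by (auto simp: h_def v_def)
  define x where "x = sqrt (h / (v * s\<^sub>1)) * (s\<^sub>2 - h * t\<^sub>2)"
  define T where "T n = s\<^sub>1 / h * real n + t\<^sub>2 * sqrt (real n)" for n :: nat
  define N where "N n = s\<^sub>1 * real n + s\<^sub>2 * sqrt (real n)" for n :: nat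
  define m where "m n = nat \<lfloor>T n\<rfloor>" for n
  have T_top: "filterlim T at_top sequentially"
    unfolding T_def using s \<open>h > 0\<close> by real_asymp
  have N_top: "filterlim N at_top sequentially"
    unfolding N_def using s by real_asymp
  have T_nonneg: "eventually (\<lambda>n. 0 \<le> T n) sequentially"
    using T_top by (simp add: filterlim_at_top)
  have N_nonneg: "eventually (\<lambda>n. 0 \<le> N n) sequentially"
    using N_top by (simp add: filterlim_at_top)
  have diff: "eventually (\<lambda>n. \<bar>real (m n) - T n\<bar> \<le> 1) sequentially"
    using T_nonneg by eventually_elim (unfold m_def, rule abs_nat_floor_diff_le)
  have m_top: "filterlim m at_top sequentially"
  proof -
    have "filterlim (\<lambda>n. T n - 1) at_top sequentially"
      unfolding T_def using s \<open>h > 0\<close> by real_asymp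
    then have "filterlim (\<lambda>n. real (m n)) at_top sequentially"
      by (rule filterlim_at_top_mono) (use diff in \<open>eventually_elim, linarith\<close>)
    then show ?thesis by (simp add: filterlim_sequentially_iff_filterlim_real)
  qed
  \<comment> \<open>Rounding changes the number of copies by at most 1, which disappears after
    division by any diverging normalisation; \<open>sqrt (real n)\<close> and \<open>real n\<close>
    are the cases needed.\<close>
  have diff_over: "(\<lambda>n. (real (m n) - T n) / f n) \<longlonglongrightarrow> 0"
    if "filterlim f at_top sequentially" for f :: "nat \<Rightarrow> real"
  proof (rule Lim_null_comparison)
    show "(\<lambda>n. 1 / f n) \<longlonglongrightarrow> 0"
      using that by (intro tendsto_divide_0[OF tendsto_const] filterlim_at_top_imp_at_infinity)
    have "eventually (\<lambda>n. 0 < f n) sequentially" using that by (simp add: filterlim_at_top_dense)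
    with diff show "\<forall>\<^sub>F n in sequentially. norm ((real (m n) - T n) / f n) \<le> 1 / f n"
      by eventually_elim (simp add: divide_right_mono)
  qed
  have clt: "(\<lambda>n. measure (iid (m n) Q) {w. 2 powr - (N n + e n) \<le> pmf (iid (m n) Q) w}) \<longlonglongrightarrow> Phi x"
    if e: "(\<lambda>n. e n / sqrt (real n)) \<longlonglongrightarrow> 0" for e :: "nat \<Rightarrow> real"
  proof (rule iid_typical_central_limit[OF V m_top], unfold h_def[symmetric] v_def[symmetric])
    have sqrt_top: "filterlim (\<lambda>n::nat. sqrt (real n)) at_top sequentially" by real_asymp
    \<comment> \<open>Numerator and denominator of the normalised threshold are both divided by
      \<open>sqrt (real n)\<close>, so that each has a finite limit.\<close>
    have num: "(\<lambda>n. (s\<^sub>2 - h * t\<^sub>2) + e n / sqrt (real n) - h * ((real (m n) - T n) / sqrt (real n)))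
        \<longlonglongrightarrow> (s\<^sub>2 - h * t\<^sub>2) + 0 - h * 0"
      by (intro tendsto_intros e diff_over sqrt_top)
    have "(\<lambda>n::nat. s\<^sub>1 / h + t\<^sub>2 / sqrt (real n)) \<longlonglongrightarrow> s\<^sub>1 / h" by real_asymp
    from tendsto_add[OF this diff_over[OF filterlim_real_sequentially]]
    have den: "(\<lambda>n. sqrt (((s\<^sub>1 / h + t\<^sub>2 / sqrt (real n)) + (real (m n) - T n) / real n) * v))
        \<longlonglongrightarrow> sqrt ((s\<^sub>1 / h + 0) * v)"
      by (intro tendsto_real_sqrt tendsto_mult tendsto_const)
    have "sqrt ((s\<^sub>1 / h + 0) * v) \<noteq> 0" using s \<open>h > 0\<close> \<open>v > 0\<close> by simp
    from tendsto_divide[OF num den this]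
    have "(\<lambda>n. ((s\<^sub>2 - h * t\<^sub>2) + e n / sqrt (real n) - h * ((real (m n) - T n) / sqrt (real n))) /
        sqrt (((s\<^sub>1 / h + t\<^sub>2 / sqrt (real n)) + (real (m n) - T n) / real n) * v)) \<longlonglongrightarrow> x"
    proof (rule tendsto_eq_rhs)
      show "(s\<^sub>2 - h * t\<^sub>2 + 0 - h * 0) / sqrt ((s\<^sub>1 / h + 0) * v) = x"
        using s \<open>h > 0\<close> \<open>v > 0\<close> by (simp add: x_def real_sqrt_divide real_sqrt_mult mult_ac)
    qed
    moreover have "eventually (\<lambda>n.
        ((s\<^sub>2 - h * t\<^sub>2) + e n / sqrt (real n) - h * ((real (m n) - T n) / sqrt (real n))) /
        sqrt (((s\<^sub>1 / h + t\<^sub>2 / sqrt (real n)) + (real (m n) - T n) / real n) * v) =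
        (N n + e n - real (m n) * h) / sqrt (real (m n) * v)) sequentially"
      using eventually_gt_at_top[of 0]
    proof eventually_elim
      case (elim n)
      define r where "r = sqrt (real n)"
      have "r > 0" "real n = r * r" using elim by (auto simp: r_def)
      have "(s\<^sub>2 - h * t\<^sub>2) + e n / r - h * ((real (m n) - T n) / r) = (N n + e n - real (m n) * h) / r"
        using \<open>r > 0\<close> \<open>h > 0\<close> unfolding T_def N_def r_def[symmetric] \<open>real n = r * r\<close>
        by (simp add: field_simps)
      moreover have "((s\<^sub>1 / h + t\<^sub>2 / r) + (real (m n) - T n) / (r * r)) * v = real (m n) * v / (r * r)"
        using \<open>r > 0\<close> \<open>h > 0\<close> unfolding T_def r_def[symmetric] \<open>real n = r * r\<close>
        by (simp add: field_simps)
      moreover have "sqrt (real (m n) * v / (r * r)) = sqrt (real (m n) * v) / r"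
        using \<open>r > 0\<close> by (simp add: real_sqrt_divide)
      ultimately show ?case
        unfolding r_def[symmetric] \<open>real n = r * r\<close> using \<open>r > 0\<close> by simp
    qed
    ultimately show "(\<lambda>n. (N n + e n - real (m n) * h) / sqrt (real (m n) * v)) \<longlonglongrightarrow> x"
      by (rule Lim_transform_eventually)
  qed
  \<comment> \<open>The shift \<open>ln (real n)\<close> diverges, which removes the storage term,
    yet it is negligible against \<open>sqrt (real n)\<close>.\<close>
  have upper: "(\<lambda>n. sqrt (measure (iid (m n) Q) {w. 2 powr - (N n + ln (real n)) \<le> pmf (iid (m n) Q) w} +
      2 powr (N n - (N n + ln (real n))))) \<longlonglongrightarrow> sqrt (Phi x)"
  proof -
    have "(\<lambda>n::nat. 2 powr - ln (real n)) \<longlonglongrightarrow> 0" by real_asymp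
    moreover have "(\<lambda>n. measure (iid (m n) Q)
        {w. 2 powr - (N n + ln (real n)) \<le> pmf (iid (m n) Q) w}) \<longlonglongrightarrow> Phi x"
      by (rule clt) real_asymp
    ultimately have "(\<lambda>n. sqrt (measure (iid (m n) Q)
        {w. 2 powr - (N n + ln (real n)) \<le> pmf (iid (m n) Q) w} + 2 powr - ln (real n)))
        \<longlonglongrightarrow> sqrt (Phi x + 0)"
      by (intro tendsto_intros)
    then show ?thesis by simp
  qed
  \<comment> \<open>With half the gap, \<open>shannon_entropy P - \<delta>\<close> equals
    \<open>s\<^sub>1 + \<delta>\<close>. Most source words are then rarer than the inverse storage
    size by a factor exponential in \<open>n\<close>.\<close>
  define \<delta> where "\<delta> = (shannon_entropy P - s\<^sub>1) / 2"
  have "\<delta> > 0" using s by (simp add: \<delta>_def)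
  have q: "(\<lambda>n. measure (iid (m n) Q) {w. 2 powr - N n \<le> pmf (iid (m n) Q) w}) \<longlonglongrightarrow> Phi x"
    using clt[of "\<lambda>_. 0"] by simp
  have lower: "(\<lambda>n. sqrt (measure (iid (m n) Q) {w. 2 powr - N n \<le> pmf (iid (m n) Q) w}) *
      (1 - measure (iid n P) {w. 2 powr - (real n * (shannon_entropy P - \<delta>)) \<le> pmf (iid n P) w}
        - 2 powr (N n - real n * (shannon_entropy P - \<delta>)))) \<longlonglongrightarrow> sqrt (Phi x)"
  proof -
    have "N n - real n * (shannon_entropy P - \<delta>) = s\<^sub>2 * sqrt (real n) - \<delta> * real n" for n
      by (simp add: N_def \<delta>_def field_simps)
    moreover have "(\<lambda>n::nat. 2 powr (s\<^sub>2 * sqrt (real n) - \<delta> * real n)) \<longlonglongrightarrow> 0"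
      using \<open>\<delta> > 0\<close> by real_asymp
    ultimately have "(\<lambda>n. 2 powr (N n - real n * (shannon_entropy P - \<delta>))) \<longlonglongrightarrow> 0" by simp
    then have "(\<lambda>n. sqrt (measure (iid (m n) Q) {w. 2 powr - N n \<le> pmf (iid (m n) Q) w}) *
      (1 - measure (iid n P) {w. 2 powr - (real n * (shannon_entropy P - \<delta>)) \<le> pmf (iid n P) w}
        - 2 powr (N n - real n * (shannon_entropy P - \<delta>)))) \<longlonglongrightarrow> sqrt (Phi x) * (1 - 0 - 0)"
      by (intro tendsto_intros q iid_typical_upper \<open>\<delta> > 0\<close>)
    then show ?thesis by simp
  qed
  have "(\<lambda>n. iid_fidelity i P n Q (T n) (N n)) \<longlonglongrightarrow> sqrt (Phi x)"
  proof (rule tendsto_sandwich[OF _ _ lower upper])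
    have "eventually (\<lambda>n. 0 < measure (iid (m n) Q) {w. 2 powr - N n \<le> pmf (iid (m n) Q) w}) sequentially"
      using q Phi_bounds(1) by (rule order_tendstoD)
    then show "\<forall>\<^sub>F n in sequentially. sqrt (measure (iid (m n) Q) {w. 2 powr - N n \<le> pmf (iid (m n) Q) w}) *
        (1 - measure (iid n P) {w. 2 powr - (real n * (shannon_entropy P - \<delta>)) \<le> pmf (iid n P) w}
          - 2 powr (N n - real n * (shannon_entropy P - \<delta>))) \<le> iid_fidelity i P n Q (T n) (N n)"
      by eventually_elim (unfold m_def, rule iid_fidelity_ge, auto)
    show "\<forall>\<^sub>F n in sequentially. iid_fidelity i P n Q (T n) (N n) \<le>
      sqrt (measure (iid (m n) Q) {w. 2 powr - (N n + ln (real n)) \<le> pmf (iid (m n) Q) w} +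
        2 powr (N n - (N n + ln (real n))))"
      using N_nonneg by eventually_elim (unfold m_def, rule iid_fidelity_le_storage)
  qed
  then show ?thesis
    unfolding T_def N_def limit_fidelity_def x_def h_def v_def .
qed

section \<open>First-order rates and the status of the rate pair\<close>

lemma exponential_decay:
  fixes k r :: real
  shows "k > 0 \<Longrightarrow> (\<lambda>n::nat. 2 powr (r - k * real n)) \<longlonglongrightarrow> 0"
  by real_asymp

text \<open>The weak law suffices at first order. At a rate \<open>a\<close> above
  \<open>shannon_entropy Q * t\<close> and within the storage, the likely target words carry almost
  all mass, and source words of rate \<open>b > a\<close> are fine enough to simulate them.\<close>

lemma liminf_iid_fidelity_ge_1:
  fixes P :: "'a::finite pmf" and Q :: "'b::finite pmf" and s t :: real
  assumes "0 < t" "shannon_entropy Q * t < shannon_entropy P" "shannon_entropy Q * t < s"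
  shows "1 \<le> liminf (\<lambda>n. ereal (iid_fidelity i P n Q (t * real n) (s * real n)))"
proof -
  obtain a where a: "shannon_entropy Q * t < a" "a < min (shannon_entropy P) s"
    using dense[of "shannon_entropy Q * t" "min (shannon_entropy P) s"] assms by auto
  obtain b where b: "a < b" "b < shannon_entropy P" using a dense[of a "shannon_entropy P"] by auto
  define m where "m n = nat \<lfloor>t * real n\<rfloor>" for n :: nat
  have m_top: "filterlim m at_top sequentially"
    unfolding m_def using \<open>0 < t\<close> by real_asymp
  \<comment> \<open>Since \<open>m n\<close> is about \<open>t * real n\<close>, the rate
    \<open>a\<close> per source copy is \<open>a / t\<close> per target copy, written here as
    entropy plus \<delta>.\<close>
  define \<delta> where "\<delta> = a / t - shannon_entropy Q"
  have "\<delta> > 0" using a \<open>0 < t\<close> by (simp add: \<delta>_def field_simps)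
  have q: "(\<lambda>n. measure (iid (m n) Q) {w. 2 powr - (real n * a) \<le> pmf (iid (m n) Q) w}) \<longlonglongrightarrow> 1"
  proof (rule tendsto_sandwich)
    show "(\<lambda>n. measure (iid (m n) Q) {w. 2 powr - (real (m n) * (shannon_entropy Q + \<delta>))
        \<le> pmf (iid (m n) Q) w}) \<longlonglongrightarrow> 1"
      by (rule filterlim_compose[OF iid_typical_lower[OF \<open>\<delta> > 0\<close>] m_top])
    show "\<forall>\<^sub>F n in sequentially. measure (iid (m n) Q)
        {w. 2 powr - (real (m n) * (shannon_entropy Q + \<delta>)) \<le> pmf (iid (m n) Q) w}
        \<le> measure (iid (m n) Q) {w. 2 powr - (real n * a) \<le> pmf (iid (m n) Q) w}"
    proof (intro always_eventually allI)
      fix n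
      have "0 \<le> shannon_entropy Q * t" using \<open>0 < t\<close> shannon_entropy_nonneg[of Q] by simp
      then have "0 \<le> a" using a by linarith
      have "real (m n) \<le> t * real n" using \<open>0 < t\<close> by (simp add: m_def)
      then have "real (m n) * (a / t) \<le> t * real n * (a / t)"
        using \<open>0 < t\<close> \<open>0 \<le> a\<close> by (intro mult_right_mono) auto
      then have "real (m n) * (shannon_entropy Q + \<delta>) \<le> real n * a"
        using \<open>0 < t\<close> by (simp add: \<delta>_def)
      then have *: "2 powr - (real n * a) \<le> 2 powr - (real (m n) * (shannon_entropy Q + \<delta>))" by simp
      show "measure (iid (m n) Q)
          {w. 2 powr - (real (m n) * (shannon_entropy Q + \<delta>)) \<le> pmf (iid (m n) Q) w}
          \<le> measure (iid (m n) Q) {w. 2 powr - (real n * a) \<le> pmf (iid (m n) Q) w}"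
        by (intro measure_pmf.finite_measure_mono) (auto intro: order_trans[OF *])
    qed
  qed auto
  define \<gamma> where "\<gamma> = shannon_entropy P - b"
  have "\<gamma> > 0" using b by (simp add: \<gamma>_def)
  let ?u = "\<lambda>n. sqrt (measure (iid (m n) Q) {w. 2 powr - (real n * a) \<le> pmf (iid (m n) Q) w}) *
      (1 - measure (iid n P) {w. 2 powr - (real n * (shannon_entropy P - \<gamma>)) \<le> pmf (iid n P) w}
        - 2 powr (real n * a - real n * (shannon_entropy P - \<gamma>)))"
  have "(\<lambda>n::nat. 2 powr (real n * a - real n * b)) \<longlonglongrightarrow> 0"
    using exponential_decay[of "b - a" 0] b by (simp add: algebra_simps)
  then have "(\<lambda>n. 2 powr (real n * a - real n * (shannon_entropy P - \<gamma>))) \<longlonglongrightarrow> 0"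
    by (simp add: \<gamma>_def)
  then have "?u \<longlonglongrightarrow> sqrt 1 * (1 - 0 - 0)"
    by (intro tendsto_intros q iid_typical_upper \<open>\<gamma> > 0\<close>)
  then have "?u \<longlonglongrightarrow> 1" by simp
  then have lim: "liminf (\<lambda>n. ereal (?u n)) = 1"
    unfolding one_ereal_def by (intro lim_imp_Liminf) (simp_all only: lim_ereal trivial_limit_sequentially not_False_eq_True)
  have "liminf (\<lambda>n. ereal (?u n)) \<le> liminf (\<lambda>n. ereal (iid_fidelity i P n Q (t * real n) (s * real n)))"
  proof (rule Liminf_mono)
    have "eventually (\<lambda>n. 0 < measure (iid (m n) Q) {w. 2 powr - (real n * a) \<le> pmf (iid (m n) Q) w}) sequentially"
      using q zero_less_one by (rule order_tendstoD)
    then show "\<forall>\<^sub>F n in sequentially. ereal (?u n) \<le> ereal (iid_fidelity i P n Q (t * real n) (s * real n))"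
    proof eventually_elim
      case (elim n)
      have "real n * a \<le> s * real n" using a by (simp add: mult.commute mult_right_mono)
      then show ?case
        using elim iid_fidelity_ge[of "real n * a" "s * real n" "t * real n" Q] by (simp add: m_def)
    qed
  qed
  then show ?thesis unfolding lim .
qed

text \<open>Choose rates \<open>a < b\<close> between \<open>shannon_entropy P\<close> and
  \<open>shannon_entropy Q * t\<close>. At most \<open>2 powr (real n * a)\<close> source words
  carry almost all source mass, while target words likelier than about
  \<open>2 powr - (real n * b)\<close> have vanishing total mass, so both terms of the source bound
  tend to 0.\<close>

lemma liminf_iid_fidelity_le_0:
  fixes P :: "'a::finite pmf" and Q :: "'b::finite pmf" and s t :: real
  assumes "0 < t" "0 < s" "shannon_entropy P < shannon_entropy Q * t"
  shows "liminf (\<lambda>n. ereal (iid_fidelity i P n Q (t * real n) (s * real n))) \<le> 0"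
proof -
  obtain a where a: "shannon_entropy P < a" "a < shannon_entropy Q * t" using dense assms by blast
  obtain b where b: "a < b" "b < shannon_entropy Q * t" using dense a by blast
  define m where "m n = nat \<lfloor>t * real n\<rfloor>" for n :: nat
  have m_top: "filterlim m at_top sequentially"
    unfolding m_def using \<open>0 < t\<close> by real_asymp
  define \<delta> where "\<delta> = shannon_entropy Q - b / t"
  have "\<delta> > 0" using b \<open>0 < t\<close> by (simp add: \<delta>_def field_simps)
  define \<gamma> where "\<gamma> = a - shannon_entropy P"
  have "\<gamma> > 0" using a by (simp add: \<gamma>_def)
  let ?c = "\<lambda>n. real (m n) * (shannon_entropy Q - \<delta>)"
  let ?d = "\<lambda>n. real n * (shannon_entropy P + \<gamma>)"
  let ?u = "\<lambda>n. sqrt (measure (iid (m n) Q) {w. 2 powr - ?c n \<le> pmf (iid (m n) Q) w} + 2 powr (?d n - ?c n)) +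
    sqrt (1 - measure (iid n P) {w. 2 powr - ?d n \<le> pmf (iid n P) w})"
  have "(\<lambda>n. 2 powr (?d n - ?c n)) \<longlonglongrightarrow> 0"
  proof (rule tendsto_sandwich[OF _ _ tendsto_const])
    \<comment> \<open>The constant \<open>\<bar>b / t\<bar>\<close> absorbs the effect on the
      exponent of rounding \<open>t * real n\<close> down to \<open>m n\<close>.\<close>
    show "(\<lambda>n. 2 powr (\<bar>b / t\<bar> - (b - a) * real n)) \<longlonglongrightarrow> 0"
      using b by (intro exponential_decay) simp
    have "?d n - ?c n \<le> \<bar>b / t\<bar> - (b - a) * real n" for n
    proof -
      have "\<bar>real (m n) - t * real n\<bar> \<le> 1"
        unfolding m_def using \<open>0 < t\<close> by (intro abs_nat_floor_diff_le) simp
      then have "\<bar>(real (m n) - t * real n) * (b / t)\<bar> \<le> 1 * \<bar>b / t\<bar>"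
        unfolding abs_mult by (rule mult_right_mono) simp
      moreover have "(real (m n) - t * real n) * (b / t) = ?c n - real n * b"
        using \<open>0 < t\<close> by (simp add: \<delta>_def field_simps)
      ultimately show ?thesis by (simp add: \<gamma>_def algebra_simps)
    qed
    then show "\<forall>\<^sub>F n in sequentially. 2 powr (?d n - ?c n) \<le> 2 powr (\<bar>b / t\<bar> - (b - a) * real n)"
      by (intro always_eventually allI) simp
  qed simp
  moreover have "(\<lambda>n. measure (iid (m n) Q) {w. 2 powr - ?c n \<le> pmf (iid (m n) Q) w}) \<longlonglongrightarrow> 0"
    by (rule filterlim_compose[OF iid_typical_upper[OF \<open>\<delta> > 0\<close>] m_top])
  ultimately have "?u \<longlonglongrightarrow> sqrt (0 + 0) + sqrt (1 - 1)"
    by (intro tendsto_intros iid_typical_lower \<open>\<gamma> > 0\<close>)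
  then have "?u \<longlonglongrightarrow> 0" by simp
  then have lim: "liminf (\<lambda>n. ereal (?u n)) = 0"
    unfolding zero_ereal_def by (intro lim_imp_Liminf) (simp_all only: lim_ereal trivial_limit_sequentially not_False_eq_True)
  have "liminf (\<lambda>n. ereal (iid_fidelity i P n Q (t * real n) (s * real n))) \<le> liminf (\<lambda>n. ereal (?u n))"
    using \<open>0 < s\<close> unfolding m_def
    by (intro Liminf_mono always_eventually allI) (simp add: iid_fidelity_le_source)
  then show ?thesis unfolding lim .
qed

text \<open>
  Failing admissibility without failing semi-admissibility yields an achievable pair \<open>(s', t')\<close> with
  \<open>t' > t\<close>. If \<open>s \<ge> H(P)\<close>, the converse bound \<open>t' \<le> H(P) / H(Q)\<close> makes \<open>(s, u)\<close> achievable for every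
  \<open>u\<close> strictly between \<open>t\<close> and \<open>t'\<close>, and such a pair dominates \<open>(s, t)\<close>.
\<close>

lemma semi_admissible_not_admissible_imp_less:
  fixes P :: "'a::finite pmf" and Q :: "'b::finite pmf" and s t \<nu> :: real
  assumes "0 < \<nu>" "\<nu> < 1" and H: "0 < shannon_entropy Q"
    and semi: "semi_admissible i \<nu> P Q (s, t)" and not_adm: "\<not> admissible i \<nu> P Q (s, t)"
  shows "0 < s" "s < shannon_entropy P"
proof -
  have st: "0 < s" "0 < t" using semi by (auto simp: semi_admissible_def achievable_def)
  then show "0 < s" by simp
  \<comment> \<open>Semi-admissibility excludes dominating competitors, so the one that defeats
    admissibility must simulate the pair.\<close>
  obtain s' t' where r': "(s', t') \<noteq> (s, t)" "achievable i \<nu> P Q (s', t')" "simulates (s', t') (s, t)"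
    using semi not_adm unfolding semi_admissible_def admissible_def by auto
  then have pos: "0 < s'" "0 < t'" by (auto simp: achievable_def)
  have "s / s' = t / t'" "t / t' \<le> 1" using r'(3) by (auto simp: simulates_def)
  have "t < t'"
  proof (rule ccontr)
    assume "\<not> t < t'"
    then have "t / t' = 1" using \<open>t / t' \<le> 1\<close> pos by (simp add: field_simps)
    then have "s' = s" "t' = t" using \<open>s / s' = t / t'\<close> pos by auto
    with r'(1) show False by simp
  qed
  show "s < shannon_entropy P"
  proof (rule ccontr)
    assume "\<not> s < shannon_entropy P"
    have "shannon_entropy Q * t' \<le> shannon_entropy P"
    proof (rule ccontr)
      assume "\<not> shannon_entropy Q * t' \<le> shannon_entropy P"
      then have "liminf (\<lambda>n. ereal (iid_fidelity i P n Q (t' * real n) (s' * real n))) \<le> 0"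
        using pos by (intro liminf_iid_fidelity_le_0) auto
      moreover have "ereal \<nu> \<le> liminf (\<lambda>n. ereal (iid_fidelity i P n Q (t' * real n) (s' * real n)))"
        using r'(2) by (simp add: achievable_def)
      ultimately have "ereal \<nu> \<le> 0" by (rule order_trans[rotated])
      with \<open>0 < \<nu>\<close> show False by simp
    qed
    obtain u where u: "t < u" "u < t'" using dense[OF \<open>t < t'\<close>] by blast
    have "shannon_entropy Q * u < shannon_entropy Q * t'" using u H by simp
    then have "1 \<le> liminf (\<lambda>n. ereal (iid_fidelity i P n Q (u * real n) (s * real n)))"
      using \<open>shannon_entropy Q * t' \<le> shannon_entropy P\<close> \<open>\<not> s < shannon_entropy P\<close> u st
      by (intro liminf_iid_fidelity_ge_1) auto
    then have "achievable i \<nu> P Q (s, u)"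
      using \<open>\<nu> < 1\<close> st u by (auto simp: achievable_def intro: order_trans[of "ereal \<nu>" 1])
    moreover have "(s, u) \<noteq> (s, t)" "dominates (s, u) (s, t)" using u by (auto simp: dominates_def)
    ultimately show False using semi unfolding semi_admissible_def by blast
  qed
qed

theorem theorem25:
  fixes P :: "'a::finite pmf" and Q :: "'b::finite pmf"
    and s\<^sub>1 t\<^sub>1 s\<^sub>2 \<nu> :: real and i :: conversion
  assumes "0 < \<nu>" "\<nu> < 1"
    and "varentropy Q > 0"
    and "semi_admissible i \<nu> P Q (s\<^sub>1, t\<^sub>1)"
    and "\<not> admissible i \<nu> P Q (s\<^sub>1, t\<^sub>1)"
  shows "continuous_on (limit_fidelity Q s\<^sub>1 s\<^sub>2 -` {0<..<1}) (limit_fidelity Q s\<^sub>1 s\<^sub>2)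
    \<and> strict_antimono_on (limit_fidelity Q s\<^sub>1 s\<^sub>2 -` {0<..<1}) (limit_fidelity Q s\<^sub>1 s\<^sub>2)
    \<and> (\<forall>t\<^sub>2. second_order_fidelity Deterministic P Q s\<^sub>1 s\<^sub>2 t\<^sub>2 = ereal (limit_fidelity Q s\<^sub>1 s\<^sub>2 t\<^sub>2)
          \<and> second_order_fidelity Majorization P Q s\<^sub>1 s\<^sub>2 t\<^sub>2 = ereal (limit_fidelity Q s\<^sub>1 s\<^sub>2 t\<^sub>2))"
proof (intro conjI allI)
  have H: "0 < shannon_entropy Q" using assms(3) by (rule shannon_entropy_pos)
  \<comment> \<open>From here on the rate pair enters only through \<open>s\<^sub>1\<close> lying
    strictly between 0 and the entropy of \<open>P\<close>.\<close>
  note s1 = semi_admissible_not_admissible_imp_less[OF assms(1,2) H assms(4,5)]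
  have cont: "continuous_on UNIV Phi"
    by (simp add: continuous_on_eq_continuous_at isCont_Phi)
  show "continuous_on (limit_fidelity Q s\<^sub>1 s\<^sub>2 -` {0<..<1}) (limit_fidelity Q s\<^sub>1 s\<^sub>2)"
    unfolding limit_fidelity_def[abs_def]
    by (intro continuous_intros continuous_on_compose2[OF cont]) auto
  show "strict_antimono_on (limit_fidelity Q s\<^sub>1 s\<^sub>2 -` {0<..<1}) (limit_fidelity Q s\<^sub>1 s\<^sub>2)"
  proof (rule monotone_onI)
    fix x y :: real assume "x < y"
    have "0 < sqrt (shannon_entropy Q / (varentropy Q * s\<^sub>1))" using H s1 assms(3) by simp
    moreover have "s\<^sub>2 - shannon_entropy Q * y < s\<^sub>2 - shannon_entropy Q * x" using \<open>x < y\<close> H by simp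
    ultimately show "limit_fidelity Q s\<^sub>1 s\<^sub>2 x > limit_fidelity Q s\<^sub>1 s\<^sub>2 y"
      unfolding limit_fidelity_def
      by (intro real_sqrt_less_mono strict_monoD[OF Phi_strict_mono] mult_strict_left_mono)
  qed
  have limit: "second_order_fidelity j P Q s\<^sub>1 s\<^sub>2 t\<^sub>2 = ereal (limit_fidelity Q s\<^sub>1 s\<^sub>2 t\<^sub>2)" for j t\<^sub>2
    unfolding second_order_fidelity_def
    using iid_fidelity_tendsto_second_order[OF assms(3) s1] by (intro lim_imp_Liminf) auto
  fix t\<^sub>2
  show "second_order_fidelity Deterministic P Q s\<^sub>1 s\<^sub>2 t\<^sub>2 = ereal (limit_fidelity Q s\<^sub>1 s\<^sub>2 t\<^sub>2)"
    "second_order_fidelity Majorization P Q s\<^sub>1 s\<^sub>2 t\<^sub>2 = ereal (limit_fidelity Q s\<^sub>1 s\<^sub>2 t\<^sub>2)"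
    by (rule limit)+
qed

end
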